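(* Let $G$ be a finite simple graph with maximum degree $\Delta$. (a) If $\mathrm{mad}(G) \leq \frac{5}{2}$, then $\chi_i(G)\leq \Delta + 1$. (b) If $\mathrm{mad}(G) < \frac{42}{19}$, then $\chi_i(G)=\Delta$.
   Context: An injective coloring of a graph $G$ is an assignment of colors to the vertices of $G$ such that any two vertices having a common neighbor receive distinct colors (the coloring need not be proper). The injective chromatic number $\chi_i(G)$ is the minimum number of colors in an injective coloring of $G$. The maximum average degree $\mathrm{mad}(G)$ is the maximum, over all nonempty subgraphs $H$ of $G$, of the average degree $2|E(H)|/|V(H)|$. $\Delta$ denotes the maximum degree of $G$.
   Formalization: Part (b) is proved only for Δ other than 0 and 2, since as stated it fails there: a single vertex has Δ = 0 and injective chromatic number 1; a triangle has mad = 2, Δ = 2 and injective chromatic number 3. Graphs with Δ = 2 for which equality does hold (e.g. paths) are not covered. *)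

theory Defs
  imports Complex_Main
begin

text \<open>A graph is given by its vertex set \<open>V\<close> and its edge set \<open>E\<close> of two-element subsets of \<open>V\<close>.\<close>

definition simple_graph :: "'a set \<Rightarrow> 'a set set \<Rightarrow> bool" where
  "simple_graph V E \<longleftrightarrow> finite V \<and> (\<forall>e\<in>E. e \<subseteq> V \<and> card e = 2)"

definition degree :: "'a set set \<Rightarrow> 'a \<Rightarrow> nat" where
  "degree E v = card {u. {u, v} \<in> E}"

text \<open>Inserting \<open>0\<close> in this maximum, and in \<open>mad\<close> below, matters only for the graph without
  vertices: degrees and average degrees are non-negative, and the one-vertex subgraphs of any
  other graph have average degree \<open>0\<close>.\<close>

definition max_degree :: "'a set \<Rightarrow> 'a set set \<Rightarrow> nat" where
  "max_degree V E = Max (insert 0 (degree E ` V))"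

definition avg_degree :: "'a set \<Rightarrow> 'a set set \<Rightarrow> real" where
  "avg_degree W F = 2 * real (card F) / real (card W)"

definition mad :: "'a set \<Rightarrow> 'a set set \<Rightarrow> real" where
  "mad V E = Max (insert 0 {avg_degree W F |W F. simple_graph W F \<and> W \<subseteq> V \<and> F \<subseteq> E \<and> W \<noteq> {}})"

definition injective_coloring :: "'a set \<Rightarrow> 'a set set \<Rightarrow> ('a \<Rightarrow> 'c) \<Rightarrow> bool" where
  "injective_coloring V E c \<longleftrightarrow>
     (\<forall>u\<in>V. \<forall>v\<in>V. u \<noteq> v \<and> (\<exists>w\<in>V. {u, w} \<in> E \<and> {v, w} \<in> E) \<longrightarrow> c u \<noteq> c v)"

text \<open>Even for small \<open>mad\<close> this number may differ from the maximum degree \<open>\<Delta>\<close> if \<open>\<Delta> = 0\<close> or \<open>\<Delta> = 2\<close>: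
  it is \<open>1\<close> for a single vertex (\<open>mad = 0\<close>) and \<open>3\<close> for a triangle (\<open>mad = 2\<close>).\<close>

definition injective_chromatic_number :: "'a set \<Rightarrow> 'a set set \<Rightarrow> nat" where
  "injective_chromatic_number V E =
     (LEAST k. \<exists>c :: 'a \<Rightarrow> nat. injective_coloring V E c \<and> card (c ` V) = k)"

end

theory Submission
  imports Defs
begin

text \<open>An injective colouring of a graph colours the points (left vertices) of its bipartite double
  cover so that the points of every block (the neighbours of a right vertex) get distinct colours.
  The double cover is at most as dense as the graph, so it suffices to colour points of sparse
  incidence relations; the gain is that deleting an incidence only forces its point to be recoloured.

  In a minimal relation that is not \<open>K\<close>-colourable, every point has at least \<open>K\<close> conflicts. For
  maximum degree at least 4 this already makes the relation too dense, by adding up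
  \<open>a - b / deg p - b / deg q\<close> over the incidences \<open>(p, q)\<close>, point by point. For maximum degree 3
  it is combined with the absence of certain cycles through points of degree 2: along such a cycle the
  points can be recoloured from lists of two colours. Without these cycles the blocks of size 3 and the
  degree-2 paths between them form a forest, and counting gives too many incidences again.\<close>

section \<open>Incidence relations and their point colourings\<close>

text \<open>The bound is asked of every element of the type, on or off the relation, so recolouring
  starts from colours in range everywhere. For \<open>K = 0\<close> even the empty relation has no
  colouring.\<close>

definition point_coloring :: "('a \<times> 'b) set \<Rightarrow> nat \<Rightarrow> ('a \<Rightarrow> nat) \<Rightarrow> bool" where
  "point_coloring I K c \<longleftrightarrow> (\<forall>p. c p < K) \<and>
     (\<forall>p p' q. (p, q) \<in> I \<and> (p', q) \<in> I \<and> p \<noteq> p' \<longrightarrow> c p \<noteq> c p')"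

definition point_degree :: "('a \<times> 'b) set \<Rightarrow> 'a \<Rightarrow> nat" where
  "point_degree I p = card (I `` {p})"

definition block_size :: "('a \<times> 'b) set \<Rightarrow> 'b \<Rightarrow> nat" where
  "block_size I q = card (I\<inverse> `` {q})"

lemma card_relation_points:
  assumes "finite I" "finite D" "Domain I \<subseteq> D"
  shows "card I = (\<Sum>p\<in>D. card (I `` {p}))"
proof -
  have "I = Sigma D (\<lambda>p. I `` {p})" using assms(3) by auto
  moreover have "card (Sigma D (\<lambda>p. I `` {p})) = (\<Sum>p\<in>D. card (I `` {p}))"
    using assms by (simp add: finite_Image)
  ultimately show ?thesis by simp
qed

lemma card_relation_blocks:
  assumes "finite I" "finite D" "Range I \<subseteq> D"
  shows "card I = (\<Sum>q\<in>D. card (I\<inverse> `` {q}))"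
proof -
  have "card I = card (I\<inverse>)" by simp
  also have "\<dots> = (\<Sum>q\<in>D. card (I\<inverse> `` {q}))"
    using assms by (intro card_relation_points) auto
  finally show ?thesis .
qed

subsection \<open>Colouring cycles from lists\<close>

lemma exists_other_element:
  assumes "2 \<le> card A" shows "\<exists>x\<in>A. x \<noteq> y"
proof (rule ccontr)
  assume "\<not> ?thesis"
  hence "A \<subseteq> {y}" by auto
  hence "card A \<le> 1" using card_mono[of "{y}" A] by simp
  thus False using assms by simp
qed

text \<open>Give some vertex a colour missing from the list of its predecessor, then go once around.\<close>

lemma cycle_list_coloring_unequal:
  fixes L :: "nat \<Rightarrow> 'c set"
  assumes n: "2 \<le> n" and L: "\<And>i. i < n \<Longrightarrow> 2 \<le> card (L i)" and per: "L n = L 0"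
    and ne: "\<exists>i<n. L i \<noteq> L (Suc i)"
  shows "\<exists>f. (\<forall>i<n. f i \<in> L i) \<and> (\<forall>i. Suc i < n \<longrightarrow> f i \<noteq> f (Suc i)) \<and> f (n - 1) \<noteq> f 0"
proof -
  \<comment> \<open>Otherwise the lists shrink along the cycle, and \<open>L n = L 0\<close> makes
    them all equal.\<close>
  have "\<exists>l<n. \<not> L (Suc l) \<subseteq> L l"
  proof (rule ccontr)
    assume "\<not> ?thesis"
    hence sub: "L (Suc l) \<subseteq> L l" if "l < n" for l using that by blast
    have mono: "L j \<subseteq> L i" if "i \<le> j" "j \<le> n" for i j
      using that by (induction j rule: dec_induct) (use sub in \<open>auto dest: Suc_le_lessD\<close>)
    obtain i where i: "i < n" "L i \<noteq> L (Suc i)" using ne by blast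
    have "L i \<subseteq> L 0" "L n \<subseteq> L (Suc i)" using i mono by auto
    thus False using i per sub[of i] by auto
  qed
  then obtain l x where l: "l < n" "x \<in> L (Suc l)" "x \<notin> L l" by blast
  \<comment> \<open>\<open>M\<close> runs through the cycle twice, so a walk starting at
    \<open>Suc l\<close> can pass index \<open>n\<close> without reduction modulo
    \<open>n\<close>.\<close>
  define M where "M j = (if j < n then L j else L (j - n))" for j
  have M: "2 \<le> card (M j)" if "j < 2 * n" for j using that L by (auto simp: M_def)
  \<comment> \<open>Greedy walk: start with \<open>x\<close>, then pick from each next list a colour
    other than the one just used.\<close>
  define h where "h = rec_nat x (\<lambda>j y. SOME z. z \<in> M (Suc l + Suc j) \<and> z \<noteq> y)"
  have h0: "h 0 = x" by (simp add: h_def)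
  have hS: "h (Suc j) \<in> M (Suc l + Suc j) \<and> h (Suc j) \<noteq> h j" if "Suc l + Suc j < 2 * n" for j
  proof -
    have "\<exists>z. z \<in> M (Suc l + Suc j) \<and> z \<noteq> h j" using exists_other_element[OF M[OF that]] by blast
    from someI_ex[OF this] show ?thesis by (simp add: h_def)
  qed
  have x0: "x \<in> M (Suc l)" using l per by (cases "Suc l = n") (auto simp: M_def)
  have hM: "h j \<in> M (Suc l + j)" if "Suc l + j < 2 * n" for j
    using that x0 h0 hS by (cases j) auto
  \<comment> \<open>Vertices after \<open>l\<close> are read off the first round, the others off the
    second; \<open>l\<close> itself comes last, and its closing edge is safe because
    \<open>x\<close> is not in \<open>L l\<close>.\<close>
  define f where "f i = h ((if i > l then i else i + n) - Suc l)" for i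
  have "f i \<in> L i" if "i < n" for i
    using hM[of "(if i > l then i else i + n) - Suc l"] that l by (auto simp: f_def M_def split: if_splits)
  moreover have "f i \<noteq> f (Suc i)" if i: "Suc i < n" for i
  proof (cases "i = l")
    case True
    have "f (Suc i) = x" using True by (simp add: f_def h0)
    moreover have "f i \<in> L l" using calculation True l i \<open>\<And>i. i < n \<Longrightarrow> f i \<in> L i\<close> by auto
    ultimately show ?thesis using l by auto
  next
    case False
    define j where "j = (if i > l then i else i + n) - Suc l"
    have "f i = h j" by (simp add: f_def j_def)
    moreover have "f (Suc i) = h (Suc j)"
      using False l i by (auto simp: f_def j_def Suc_diff_le intro!: arg_cong[of _ _ h])
    moreover have "Suc l + Suc j < 2 * n" using False l i by (auto simp: j_def)
    ultimately show ?thesis using hS[of j] by metis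
  qed
  moreover have "f (n - 1) \<noteq> f 0"
  proof (cases "l = n - 1")
    case True
    have "f 0 = x" using True l n by (simp add: f_def h0)
    moreover have "f (n - 1) \<in> L l" using \<open>\<And>i. i < n \<Longrightarrow> f i \<in> L i\<close>[of "n - 1"] True n by simp
    ultimately show ?thesis using l by auto
  next
    case False
    define j where "j = n - 1 - Suc l"
    have "f (n - 1) = h j" using False l by (auto simp: f_def j_def)
    moreover have "f 0 = h (Suc j)"
      using False l by (auto simp: f_def j_def intro!: arg_cong[of _ _ h])
    moreover have "Suc l + Suc j < 2 * n" using False l by (auto simp: j_def)
    ultimately show ?thesis using hS[of j] by metis
  qed
  ultimately show ?thesis by blast
qed

text \<open>If all lists are equal, an even cycle alternates two colours; on an odd cycle with
  larger lists, one vertex gives up a colour, which makes the lists unequal.\<close>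

lemma cycle_list_coloring:
  fixes L :: "nat \<Rightarrow> 'c set"
  assumes n: "2 \<le> n" and L: "\<And>i. i < n \<Longrightarrow> 2 \<le> card (L i)" and per: "L n = L 0"
    and good: "even n \<or> (\<exists>i<n. L i \<noteq> L (Suc i)) \<or> (\<exists>i<n. 3 \<le> card (L i))"
  shows "\<exists>f. (\<forall>i<n. f i \<in> L i) \<and> (\<forall>i. Suc i < n \<longrightarrow> f i \<noteq> f (Suc i)) \<and> f (n - 1) \<noteq> f 0"
proof (cases "\<exists>i<n. L i \<noteq> L (Suc i)")
  case True
  thus ?thesis using cycle_list_coloring_unequal[of n L] n L per by blast
next
  case False
  hence eqS: "L (Suc i) = L i" if "i < n" for i using that by auto
  have eq: "L i = L 0" if "i \<le> n" for i
    using that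
  proof (induction i)
    case (Suc i)
    thus ?case using eqS[of i] by simp
  qed simp
  show ?thesis
  proof (cases "even n")
    case True
    have c2: "2 \<le> card (L 0)" using L n by simp
    obtain x where x: "x \<in> L 0" using exists_other_element[OF c2] by blast
    obtain y where y: "y \<in> L 0" "y \<noteq> x" using exists_other_element[OF c2] by blast
    define f where "f i = (if even i then x else y)" for i :: nat
    have "odd (n - 1)" using True n by auto
    hence "f (n - 1) \<noteq> f 0" using y by (simp add: f_def)
    moreover have "f i \<in> L i" if "i < n" for i
    proof -
      have "L i = L 0" using eq[of i] that by linarith
      thus ?thesis using x y by (simp only: f_def) simp
    qed
    moreover have "f i \<noteq> f (Suc i)" for i using y by (simp add: f_def)
    ultimately show ?thesis by blast
  next
    case odd: False
    then obtain i where "i < n" "3 \<le> card (L i)" using good False by auto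
    hence c3: "3 \<le> card (L 0)" using eq[of i] by auto
    then obtain y where y: "y \<in> L 0" by (metis card.empty all_not_in_conv not_numeral_le_zero)
    \<comment> \<open>Index \<open>n\<close> is vertex 0 again, so both entries lose
      \<open>y\<close>, while the list at 1 keeps it.\<close>
    define M where "M i = (if i = 0 \<or> i = n then L 0 - {y} else L i)" for i
    have "2 \<le> card (M i)" if "i < n" for i using that L y c3 by (auto simp: M_def)
    moreover have "M n = M 0" by (simp add: M_def)
    moreover have "M 0 \<noteq> M (Suc 0)" using n y eq[of 1] by (auto simp: M_def)
    hence "\<exists>i<n. M i \<noteq> M (Suc i)" using n by (intro exI[of _ 0]) simp
    ultimately obtain f where f: "\<forall>i<n. f i \<in> M i" "\<forall>i. Suc i < n \<longrightarrow> f i \<noteq> f (Suc i)" "f (n - 1) \<noteq> f 0"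
      using cycle_list_coloring_unequal[of n M, OF n] by blast
    have "M i \<subseteq> L i" if "i < n" for i using that by (auto simp: M_def)
    thus ?thesis using f by blast
  qed
qed

text \<open>The value \<open>g 0\<close> recurs exactly at the even indices. Applied below to sets
  of forbidden colours and to block sizes.\<close>

lemma alternating_cycle_even:
  fixes g :: "nat \<Rightarrow> 'c"
  assumes "g n = g 0" and "\<And>i. i < n \<Longrightarrow> g i \<noteq> g (Suc i)" and "\<And>i. i \<le> n \<Longrightarrow> g i \<in> {x, y}"
  shows "even n"
proof -
  have "i \<le> n \<Longrightarrow> g i = g 0 \<longleftrightarrow> even i" for i
  proof (induction i)
    case (Suc i)
    have "g i \<in> {x, y}" "g (Suc i) \<in> {x, y}" "g 0 \<in> {x, y}" "g i \<noteq> g (Suc i)"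
      using assms Suc.prems by simp_all
    moreover have "g i = g 0 \<longleftrightarrow> even i" using Suc by simp
    ultimately show ?case by (metis empty_iff even_Suc insert_iff)
  qed simp
  thus ?thesis using assms(1) by blast
qed

subsection \<open>Cycles through points of degree two\<close>

text \<open>A cycle in the multigraph whose vertices are blocks and whose edges are points of degree
  2. The extra entry \<open>B n = B 0\<close> spares arithmetic modulo \<open>n\<close>; for
  \<open>n = 2\<close> the two points are parallel edges.\<close>

definition two_point_cycle :: "('a \<times> 'b) set \<Rightarrow> nat \<Rightarrow> (nat \<Rightarrow> 'a) \<Rightarrow> (nat \<Rightarrow> 'b) \<Rightarrow> bool" where
  "two_point_cycle I n u B \<longleftrightarrow> 2 \<le> n \<and> B n = B 0 \<and> inj_on B {..<n} \<and> inj_on u {..<n} \<and>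
     (\<forall>l<n. I `` {u l} = {B l, B (Suc l)})"

text \<open>A degree-2 point is an edge between its two blocks; a graph with at least as many edges as
  vertices has a nonempty subgraph of minimum degree 2.\<close>

lemma dense_core:
  assumes "finite A" "finite X" "A \<noteq> {}" "card X \<le> card A"
    and "\<And>a. a \<in> A \<Longrightarrow> card (I `` {a}) = 2" "\<And>a. a \<in> A \<Longrightarrow> I `` {a} \<subseteq> X"
  shows "\<exists>A' X'. A' \<subseteq> A \<and> A' \<noteq> {} \<and> (\<forall>a\<in>A'. I `` {a} \<subseteq> X') \<and>
           (\<forall>x\<in>X'. 2 \<le> card {a \<in> A'. (a, x) \<in> I})"
  using assms
proof (induction "card X" arbitrary: A X rule: less_induct)
  case less
  show ?case
  proof (cases "\<forall>x\<in>X. 2 \<le> card {a \<in> A. (a, x) \<in> I}")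
    case True
    thus ?thesis using less.prems(3,6) by (intro exI[of _ A] exI[of _ X]) simp
  next
    case False
    \<comment> \<open>A vertex of degree at most 1 is deleted with its edge: \<open>card X\<close>
      drops by one and \<open>card A\<close> by at most one, so the inequality survives.\<close>
    then obtain x where x: "x \<in> X" "card {a \<in> A. (a, x) \<in> I} \<le> 1" by fastforce
    define R where "R = {a \<in> A. (a, x) \<in> I}"
    have R: "R \<subseteq> A" "card R \<le> 1" using x by (auto simp: R_def)
    obtain a where "a \<in> A" using less.prems by blast
    \<comment> \<open>The two ends of one edge force at least 2 edges, so one remains after the
      deletion.\<close>
    hence "2 \<le> card X" using less.prems card_mono[of X "I `` {a}"] by auto
    hence cA: "2 \<le> card A" using less.prems by simp
    have cd: "card (A - R) = card A - card R" using R less.prems by (meson card_Diff_subset finite_subset)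
    have ne: "A - R \<noteq> {}" using cd cA R by (metis One_nat_def Suc_1 card.empty diff_is_0_eq not_less_eq_eq order_trans)
    have "\<exists>A' X'. A' \<subseteq> A - R \<and> A' \<noteq> {} \<and> (\<forall>a\<in>A'. I `` {a} \<subseteq> X') \<and>
           (\<forall>x\<in>X'. 2 \<le> card {a \<in> A'. (a, x) \<in> I})"
    proof (rule less.hyps)
      show "card (X - {x}) < card X" using x less.prems by (meson card_Diff1_less)
      show "card (X - {x}) \<le> card (A - R)" using x less.prems cd R by simp
      show "I `` {a} \<subseteq> X - {x}" if "a \<in> A - R" for a using that less.prems(6)[of a] by (auto simp: R_def)
      show "card (I `` {a}) = 2" if "a \<in> A - R" for a using that less.prems(5) by blast
      show "finite (A - R)" "finite (X - {x})" using less.prems(1,2) by simp_all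
      show "A - R \<noteq> {}" by (rule ne)
    qed
    then obtain A' X' where *: "A' \<subseteq> A - R" "A' \<noteq> {} \<and> (\<forall>a\<in>A'. I `` {a} \<subseteq> X') \<and>
           (\<forall>x\<in>X'. 2 \<le> card {a \<in> A'. (a, x) \<in> I})" by (elim exE conjE) simp
    have "A' \<subseteq> A" using *(1) by blast
    with *(2) show ?thesis by (intro exI[of _ A'] exI[of _ X']) simp
  qed
qed

text \<open>In the core of minimum degree 2, a walk can always leave a block by a point other than
  the one it came by. There are finitely many blocks, so it returns, and its first return closes a
  cycle.\<close>

lemma exists_two_point_cycle:
  assumes fin: "finite A" "finite X" and ne: "A \<noteq> {}" and le: "card X \<le> card A"
    and two: "\<And>a. a \<in> A \<Longrightarrow> card (I `` {a}) = 2" and sub: "\<And>a. a \<in> A \<Longrightarrow> I `` {a} \<subseteq> X"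
  shows "\<exists>n u B. two_point_cycle I n u B \<and> u ` {..<n} \<subseteq> A"
proof -
  have "\<exists>A' X'. A' \<subseteq> A \<and> A' \<noteq> {} \<and> (\<forall>a\<in>A'. I `` {a} \<subseteq> X') \<and>
           (\<forall>x\<in>X'. 2 \<le> card {a \<in> A'. (a, x) \<in> I})"
    by (rule dense_core[OF fin ne le two sub])
  then obtain A' X' where *: "A' \<subseteq> A" "A' \<noteq> {}" "\<forall>a\<in>A'. I `` {a} \<subseteq> X'"
      "\<forall>x\<in>X'. 2 \<le> card {a \<in> A'. (a, x) \<in> I}"
    by blast
  note A' = *(1,2) bspec[OF *(3)] bspec[OF *(4)]
  \<comment> \<open>State of the walk: the point just used and the block it led to.\<close>
  define flag where "flag w \<longleftrightarrow> fst w \<in> A' \<and> w \<in> I" for w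
  have ex0: "\<exists>w. flag w"
  proof -
    obtain a where a: "a \<in> A'" using A' by blast
    hence "I `` {a} \<noteq> {}" using two[of a] A'(1) by (metis card.empty subsetD zero_neq_numeral)
    thus ?thesis using a by (auto simp: flag_def)
  qed
  have step: "\<exists>w'. flag w' \<and> fst w' \<noteq> fst w \<and> snd w' \<noteq> snd w \<and> I `` {fst w'} = {snd w, snd w'}"
    if w: "flag w" for w
  proof -
    obtain a x where ax: "w = (a, x)" by force
    have "x \<in> X'" using w ax A'(3)[of a] by (auto simp: flag_def)
    then obtain a' where a': "a' \<in> A'" "(a', x) \<in> I" "a' \<noteq> a"
      using exists_other_element[OF A'(4), of x a] by blast
    have "card (I `` {a'}) = 2" using two a' A'(1) by blast
    then obtain y z where yz: "I `` {a'} = {y, z}" "y \<noteq> z" by (auto simp: card_2_iff)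
    moreover have "x \<in> I `` {a'}" using a'(2) by simp
    ultimately have "x = y \<or> x = z" by simp
    then obtain x' where "x' \<noteq> x" "I `` {a'} = {x, x'}" using yz by (metis insert_commute)
    thus ?thesis using a' ax by (intro exI[of _ "(a', x')"]) (auto simp: flag_def)
  qed
  obtain F where F: "\<And>i. flag (F i)"
      "\<And>i. fst (F (Suc i)) \<noteq> fst (F i) \<and> snd (F (Suc i)) \<noteq> snd (F i) \<and>
            I `` {fst (F (Suc i))} = {snd (F i), snd (F (Suc i))}"
    using dependent_nat_choice[of "\<lambda>_. flag"
        "\<lambda>_ w w'. fst w' \<noteq> fst w \<and> snd w' \<noteq> snd w \<and> I `` {fst w'} = {snd w, snd w'}"]
      ex0 step by metis
  define b where "b i = snd (F i)" for i
  have "b i \<in> X" for i using F(1)[of i] A'(1) sub by (cases "F i") (auto simp: flag_def b_def)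
  hence "\<not> inj b" using fin(2) by (meson finite_subset image_subsetI infinite_UNIV_nat finite_imageD)
  hence ex: "\<exists>j. \<exists>i<j. b i = b j" by (metis injI nat_neq_iff)
  \<comment> \<open>The first index whose block has occurred before, so the blocks from
    \<open>i\<close> to \<open>j - 1\<close> are distinct.\<close>
  define j where "j = (LEAST j. \<exists>i<j. b i = b j)"
  obtain i where i: "i < j" "b i = b j" using LeastI_ex[OF ex] by (auto simp: j_def)
  have least: "b s \<noteq> b t" if "s < t" "t < j" for s t
    using not_less_Least[of t "\<lambda>j. \<exists>i<j. b i = b j"] that by (auto simp: j_def)
  define n where "n = j - i"
  define B where "B l = b (i + l)" for l
  define u where "u l = fst (F (Suc (i + l)))" for l
  have n2: "2 \<le> n"
  proof (rule ccontr)
    assume "\<not> 2 \<le> n"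
    hence "j = Suc i" using i by (simp add: n_def)
    thus False using i F(2)[of i] by (simp add: b_def)
  qed
  have BnB: "B n = B 0" using i by (simp add: B_def n_def)
  have injB: "inj_on B {..<n}"
  proof (rule inj_onI)
    fix s t assume st: "s \<in> {..<n}" "t \<in> {..<n}" "B s = B t"
    have "b (i + s) = b (i + t)" "i + s < j" "i + t < j" using st i by (auto simp: B_def n_def)
    thus "s = t" using least[of "i+s" "i+t"] least[of "i+t" "i+s"] by (metis nat_add_left_cancel_less nat_neq_iff)
  qed
  have I: "I `` {u l} = {B l, B (Suc l)}" for l using F(2)[of "i + l"] by (simp add: u_def B_def b_def)
  \<comment> \<open>Equal points would have the same two ends, traversed in opposite directions;
    distinct blocks then force \<open>t = Suc s\<close>, but the walk never turns back.\<close>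
  have "u s \<noteq> u t" if st: "s < t" "t < n" for s t
  proof
    assume eq: "u s = u t"
    hence eqB: "{B s, B (Suc s)} = {B t, B (Suc t)}" using I by metis
    have st': "B s \<noteq> B t" using injB st by (auto simp: inj_on_def)
    hence e: "B s = B (Suc t)" "B (Suc s) = B t" using eqB by (auto simp: doubleton_eq_iff)
    have "Suc s = t" using e(2) injB st by (auto simp: inj_on_def)
    moreover have "u (Suc s) \<noteq> u s" using F(2)[of "Suc (i + s)"] by (simp add: u_def)
    ultimately show False using eq by simp
  qed
  hence "inj_on u {..<n}" by (auto simp: inj_on_def) (metis nat_neq_iff)
  moreover have "u ` {..<n} \<subseteq> A" using F(1) A'(1) by (auto simp: u_def flag_def)
  ultimately show ?thesis using n2 BnB injB I
    by (intro exI[of _ n] exI[of _ u] exI[of _ B]) (simp add: two_point_cycle_def)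
qed

text \<open>Since the blocks are distinct, each lies on only the two cycle points next to it. Hence
  recoloured points clash only with their cyclic neighbours, and colouring a cycle from lists
  suffices.\<close>

lemma two_point_cycle_adjacent:
  assumes "two_point_cycle I n u B" "l < m" "m < n" "(u l, q) \<in> I" "(u m, q) \<in> I"
  shows "m = Suc l \<or> (l = 0 \<and> m = n - 1)"
proof -
  have inj: "inj_on B {..<n}" and wrap: "B n = B 0" using assms(1) by (auto simp: two_point_cycle_def)
  have eqD: "s = t" if "B s = B t" "s < n" "t < n" for s t using inj that by (auto simp: inj_on_def)
  have "q \<in> I `` {u l}" "q \<in> I `` {u m}" using assms by auto
  moreover have "I `` {u l} = {B l, B (Suc l)}" "I `` {u m} = {B m, B (Suc m)}"
    using assms(1-3) by (simp_all add: two_point_cycle_def)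
  ultimately have q: "q = B l \<or> q = B (Suc l)" "q = B m \<or> q = B (Suc m)" by simp_all
  show ?thesis
  \<comment> \<open>Injectivity of \<open>B\<close> covers indices below \<open>n\<close> only, so
    the wrap-around is treated apart.\<close>
  proof (cases "Suc m = n")
    case True
    hence m: "q = B m \<or> q = B 0" "m = n - 1" using q wrap by auto
    have "B l \<noteq> B m" "B (Suc l) = B m \<longrightarrow> m = Suc l" "B l = B 0 \<longrightarrow> l = 0" "B (Suc l) \<noteq> B 0"
      using eqD[of l m] eqD[of "Suc l" m] eqD[of l 0] eqD[of "Suc l" 0] assms(2,3) by force+
    thus ?thesis using q(1) m by metis
  next
    case False
    hence "Suc m < n" using assms(3) by simp
    hence "B l \<noteq> B m" "B (Suc l) = B m \<longrightarrow> m = Suc l" "B l \<noteq> B (Suc m)" "B (Suc l) \<noteq> B (Suc m)"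
      using eqD[of l m] eqD[of "Suc l" m] eqD[of l "Suc m"] eqD[of "Suc l" "Suc m"] assms(2,3) by force+
    thus ?thesis using q by metis
  qed
qed

text \<open>The cycle points leaving and entering \<open>B l\<close> both belong to it; only the
  remaining points of the block can forbid colours there.\<close>

lemma two_point_cycle_outside:
  assumes "two_point_cycle I n u B" "finite I" "l \<le> n"
  shows "card (I\<inverse> `` {B l} - u ` {..<n}) \<le> block_size I (B l) - 2"
proof -
  \<comment> \<open>\<open>m\<close> indexes the point leaving \<open>B l\<close> and
    \<open>m'\<close> the one entering it, both cyclically.\<close>
  define m where "m = (if l = n then 0 else l)"
  define m' where "m' = (if m = 0 then n - 1 else m - 1)"
  have n: "2 \<le> n" and wrap: "B n = B 0" and inj: "inj_on u {..<n}"
    and I: "\<And>l. l < n \<Longrightarrow> I `` {u l} = {B l, B (Suc l)}"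
    using assms by (auto simp: two_point_cycle_def)
  have m: "m < n" "m' < n" "m \<noteq> m'" "B m = B l" "B (Suc m') = B l"
    using assms(3) n wrap by (auto simp: m_def m'_def)
  have "B l \<in> I `` {u m}" "B l \<in> I `` {u m'}" using I[OF m(1)] I[OF m(2)] m by auto
  hence sub: "{u m, u m'} \<subseteq> I\<inverse> `` {B l} \<inter> u ` {..<n}" using m by auto
  have "u m \<noteq> u m'" using inj m by (auto simp: inj_on_def)
  moreover have fin: "finite (I\<inverse> `` {B l})" using assms(2) by (simp add: finite_Image)
  ultimately have "2 \<le> card (I\<inverse> `` {B l} \<inter> u ` {..<n})"
    using card_mono[OF _ sub] by simp
  thus ?thesis using fin by (simp add: block_size_def card_Diff_subset_Int)
qed

subsection \<open>Critical incidence relations\<close>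

lemma card_two_cases:
  assumes "card A = 2" "x \<in> A"
  shows "\<exists>y. y \<noteq> x \<and> A = {x, y}"
proof -
  obtain a b where ab: "A = {a, b}" "a \<noteq> b" using assms(1) by (auto simp: card_2_iff)
  hence "x = a \<or> x = b" using assms(2) by simp
  thus ?thesis using ab by (metis insert_commute)
qed

text \<open>Minimality is under deleting incidences, not points: a colouring of the relation without
  \<open>(p, q)\<close> can clash only between \<open>p\<close> and other points of
  \<open>q\<close>.\<close>

locale critical =
  fixes I :: "('a \<times> 'b) set" and K :: nat
  assumes finite_I: "finite I"
    and not_colorable: "\<not> (\<exists>c. point_coloring I K c)"
    and sub_colorable: "\<And>J. J \<subset> I \<Longrightarrow> \<exists>c. point_coloring J K c"
begin

lemma finite_nbh [simp]: "finite (I `` S)" "finite (I\<inverse> `` S')"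
  using finite_I by (simp_all add: finite_Image)

lemma finite_points [simp]: "finite (Domain I)" and finite_blocks [simp]: "finite (Range I)"
  using finite_I by (simp_all add: finite_Domain finite_Range)

text \<open>Colour the relation without \<open>(p, q)\<close>. With fewer than \<open>K\<close>
  conflicting points, some colour would be free for \<open>p\<close> and repair all clashes.\<close>

lemma conflicts_ge:
  assumes "(p, q) \<in> I"
  shows "K \<le> card ((\<Union>q\<in>I `` {p}. I\<inverse> `` {q}) - {p})"
proof (rule ccontr)
  define N where "N = (\<Union>q\<in>I `` {p}. I\<inverse> `` {q}) - {p}"
  assume "\<not> ?thesis"
  hence lt: "card N < K" by (simp add: N_def)
  obtain c where c: "point_coloring (I - {(p, q)}) K c" using sub_colorable assms by blast
  have finN: "finite N" by (simp add: N_def)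
  have "card (c ` N) < card {..<K}" using lt card_image_le[OF finN, of c] by simp
  hence "\<not> {..<K} \<subseteq> c ` N" using finN by (meson card_mono finite_imageI not_le)
  then obtain x where x: "x < K" "x \<notin> c ` N" by auto
  have "point_coloring I K (c(p := x))"
    unfolding point_coloring_def
  proof (intro conjI allI impI)
    show "(c(p := x)) r < K" for r using c x by (auto simp: point_coloring_def)
    fix r r' s assume rs: "(r, s) \<in> I \<and> (r', s) \<in> I \<and> r \<noteq> r'"
    consider "r = p" | "r' = p" | "r \<noteq> p" "r' \<noteq> p" by blast
    thus "(c(p := x)) r \<noteq> (c(p := x)) r'"
    proof cases
      case 1
      hence "r' \<in> N" using rs by (auto simp: N_def)
      thus ?thesis using 1 rs x by auto
    next
      case 2
      hence "r \<in> N" using rs by (auto simp: N_def)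
      thus ?thesis using 2 rs x by auto
    next
      case 3
      hence "(r, s) \<in> I - {(p, q)}" "(r', s) \<in> I - {(p, q)}" using rs by simp_all
      hence "c r \<noteq> c r'" using rs c unfolding point_coloring_def by blast
      thus ?thesis using 3 by simp
    qed
  qed
  thus False using not_colorable by blast
qed

text \<open>The conflicts of \<open>p\<close> are covered by its blocks, each contributing its size
  minus one. Moving these ones to the left gives the term \<open>point_degree I p\<close> and avoids
  subtraction.\<close>

lemma sum_block_sizes_ge:
  assumes "p \<in> Domain I"
  shows "K + point_degree I p \<le> (\<Sum>q\<in>I `` {p}. block_size I q)"
proof -
  obtain q where q: "(p, q) \<in> I" using assms by blast
  have "(\<Union>q\<in>I `` {p}. I\<inverse> `` {q}) - {p} = (\<Union>q\<in>I `` {p}. I\<inverse> `` {q} - {p})" by blast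
  hence "K \<le> card (\<Union>q\<in>I `` {p}. I\<inverse> `` {q} - {p})" using conflicts_ge[OF q] by simp
  also have "\<dots> \<le> (\<Sum>q\<in>I `` {p}. card (I\<inverse> `` {q} - {p}))" by (rule card_UN_le) simp
  finally have "K + card (I `` {p}) \<le> (\<Sum>q\<in>I `` {p}. card (I\<inverse> `` {q} - {p}) + 1)"
    unfolding sum.distrib by simp
  also have "\<dots> = (\<Sum>q\<in>I `` {p}. block_size I q)"
  proof (rule sum.cong)
    fix q assume "q \<in> I `` {p}"
    hence "p \<in> I\<inverse> `` {q}" by auto
    from card_Suc_Diff1[OF _ this] show "card (I\<inverse> `` {q} - {p}) + 1 = block_size I q"
      by (simp add: block_size_def)
  qed simp
  finally show ?thesis by (simp add: point_degree_def)
qed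

text \<open>A block with a single point forbids nothing, so a colouring without that incidence also
  colours \<open>I\<close>.\<close>

lemma block_size_ge_2:
  assumes "q \<in> Range I"
  shows "2 \<le> block_size I q"
proof (rule ccontr)
  assume "\<not> ?thesis"
  hence "card (I\<inverse> `` {q}) \<le> 1" by (simp add: block_size_def)
  obtain p where p: "(p, q) \<in> I" using assms by blast
  have single: "p' = p" if "(p', q) \<in> I" for p'
    using p that \<open>card (I\<inverse> `` {q}) \<le> 1\<close> card_le_Suc0_iff_eq[of "I\<inverse> `` {q}"] by auto
  obtain c where c: "point_coloring (I - {(p, q)}) K c" using sub_colorable p by blast
  have "point_coloring I K c" using c single unfolding point_coloring_def by (metis Diff_iff singletonD prod.inject)
  thus False using not_colorable by blast
qed

text \<open>Delete one incidence of \<open>u 0\<close>, colour the rest, and recolour all cycle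
  points at once. \<open>lists\<close> ranges over all bounded maps because this colouring arises
  only inside the proof.\<close>

lemma no_recolorable_cycle:
  assumes cyc: "two_point_cycle I n u B"
    and lists: "\<And>c. (\<And>p. c p < K) \<Longrightarrow> \<exists>f. (\<forall>l<n. f l < K \<and>
        f l \<notin> c ` (I\<inverse> `` {B l} - u ` {..<n}) \<and> f l \<notin> c ` (I\<inverse> `` {B (Suc l)} - u ` {..<n})) \<and>
        (\<forall>l. Suc l < n \<longrightarrow> f l \<noteq> f (Suc l)) \<and> f (n - 1) \<noteq> f 0"
  shows False
proof -
  have n: "2 \<le> n" and inj: "inj_on u {..<n}" and I: "\<And>l. l < n \<Longrightarrow> I `` {u l} = {B l, B (Suc l)}"
    using cyc by (auto simp: two_point_cycle_def)
  have "(u 0, B 0) \<in> I" using I[of 0] n by auto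
  then obtain c where c: "point_coloring (I - {(u 0, B 0)}) K c" using sub_colorable by blast
  hence "c p < K" for p by (simp add: point_coloring_def)
  then obtain f where f: "\<And>l. l < n \<Longrightarrow> f l < K"
      "\<And>l. l < n \<Longrightarrow> f l \<notin> c ` (I\<inverse> `` {B l} - u ` {..<n})"
      "\<And>l. l < n \<Longrightarrow> f l \<notin> c ` (I\<inverse> `` {B (Suc l)} - u ` {..<n})"
      "\<And>l. Suc l < n \<Longrightarrow> f l \<noteq> f (Suc l)" "f (n - 1) \<noteq> f 0"
    using lists[of c] by blast
  define U where "U = u ` {..<n}"
  define c' where "c' p = (if p \<in> U then f (inv_into {..<n} u p) else c p)" for p
  have c'u: "c' (u l) = f l" if "l < n" for l using that inj by (simp add: c'_def U_def)
  have c'o: "c' p = c p" if "p \<notin> U" for p using that by (simp add: c'_def)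
  have inout: "c' p \<noteq> c' p'" if h: "p \<in> U" "p' \<notin> U" "(p, q) \<in> I" "(p', q) \<in> I" for p p' q
  proof -
    obtain l where l: "l < n" "p = u l" using h by (auto simp: U_def)
    hence "q \<in> {B l, B (Suc l)}" using I[of l] h by auto
    hence "f l \<noteq> c p'" using f(2,3)[OF l(1)] h(2,4) by (auto simp: U_def)
    thus ?thesis using l c'u c'o h by simp
  qed
  have inin: "f l \<noteq> f m" if h: "l < m" "m < n" "(u l, q) \<in> I" "(u m, q) \<in> I" for l m q
    using two_point_cycle_adjacent[OF cyc h] f(4,5) h by metis
  have "point_coloring I K c'"
    unfolding point_coloring_def
  proof (intro conjI allI impI)
    fix r
    show "c' r < K"
    proof (cases "r \<in> U")
      case True
      thus ?thesis using c'u f(1) by (auto simp: U_def)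
    next
      case False
      thus ?thesis using c c'o by (simp add: point_coloring_def)
    qed
  next
    fix r r' s assume rs: "(r, s) \<in> I \<and> (r', s) \<in> I \<and> r \<noteq> r'"
    consider "r \<in> U" "r' \<in> U" | "r \<in> U" "r' \<notin> U" | "r \<notin> U" "r' \<in> U" | "r \<notin> U" "r' \<notin> U" by blast
    thus "c' r \<noteq> c' r'"
    proof cases
      case 1
      then obtain l m where lm: "l < n" "m < n" "r = u l" "r' = u m" by (auto simp: U_def)
      hence "l \<noteq> m" using rs by auto
      thus ?thesis using inin[of l m s] inin[of m l s] lm rs c'u by (metis nat_neq_iff)
    next
      case 2
      thus ?thesis using inout rs by blast
    next
      case 3
      thus ?thesis using inout rs by metis
    next
      case 4
      \<comment> \<open>The deleted incidence belongs to \<open>u 0\<close>, so pairs off the cycle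
        keep distinct colours.\<close>
      have "u 0 \<in> U" using n by (auto simp: U_def)
      hence "r \<noteq> u 0" "r' \<noteq> u 0" using 4 by auto
      hence "(r, s) \<in> I - {(u 0, B 0)}" "(r', s) \<in> I - {(u 0, B 0)}" using rs by simp_all
      hence "c r \<noteq> c r'" using rs c unfolding point_coloring_def by blast
      thus ?thesis using 4 c'o by simp
    qed
  qed
  thus False using not_colorable by blast
qed


text \<open>For an odd cycle whose lists all coincide, each block contributes one forbidden colour, and these
  would alternate between two values around the cycle.\<close>

lemma no_two_point_cycle:
  assumes cyc: "two_point_cycle I n u B"
    and sizes: "\<And>l. l < n \<Longrightarrow> block_size I (B l) + block_size I (B (Suc l)) \<le> K + 2"
    and good: "even n \<or> (K = 4 \<and> (\<forall>l<n. block_size I (B l) = 3))"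
  shows False
proof (rule no_recolorable_cycle[OF cyc])
  fix c :: "'a \<Rightarrow> nat" assume c: "\<And>p. c p < K"
  have n: "2 \<le> n" and wrap: "B n = B 0" using cyc by (auto simp: two_point_cycle_def)
  \<comment> \<open>The colours used in \<open>B l\<close> by points off the cycle. Reduction modulo
    \<open>n\<close> gives \<open>out\<close> its meaning at \<open>n + 1\<close>, to which
    \<open>L n\<close> refers.\<close>
  define out where "out l = c ` (I\<inverse> `` {B (l mod n)} - u ` {..<n})" for l
  define L where "L l = {..<K} - (out l \<union> out (Suc l))" for l
  have Bmod: "B (l mod n) = B l" if "l \<le> n" for l using that wrap n by (cases "l = n") auto
  have out: "out l \<subseteq> {..<K}" "finite (out l)" for l using c by (auto simp: out_def)
  have card_out: "card (out l) \<le> block_size I (B l) - 2" if "l \<le> n" for l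
  proof -
    have "card (out l) \<le> card (I\<inverse> `` {B (l mod n)} - u ` {..<n})"
      unfolding out_def by (rule card_image_le) simp
    also have "\<dots> \<le> block_size I (B l) - 2"
      using two_point_cycle_outside[OF cyc finite_I that] Bmod[OF that] by simp
    finally show ?thesis .
  qed
  have size2: "2 \<le> block_size I (B l)" if "l < n" for l
  proof -
    have "B l \<in> I `` {u l}" using cyc that by (simp add: two_point_cycle_def)
    thus ?thesis using block_size_ge_2 by auto
  qed
  have size2': "2 \<le> block_size I (B l)" if "l \<le> n" for l
    using size2[of l] size2[of 0] that wrap n by (cases "l = n") auto
  \<comment> \<open>Each block forbids at most its size minus 2 colours, so the two together forbid
    at most \<open>K + 2 - 4\<close>.\<close>
  have cL: "2 \<le> card (L l)" if "l < n" for l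
  proof -
    have "card (out l \<union> out (Suc l)) \<le> card (out l) + card (out (Suc l))" by (rule card_Un_le)
    also have "\<dots> + 2 \<le> K"
      using card_out[of l] card_out[of "Suc l"] sizes[OF that] size2'[of l] size2'[of "Suc l"] that by linarith
    finally have "card (out l \<union> out (Suc l)) + 2 \<le> K" by simp
    moreover have "card (L l) = K - card (out l \<union> out (Suc l))"
      unfolding L_def using out by (subst card_Diff_subset) auto
    ultimately show ?thesis by simp
  qed
  have per: "L n = L 0" using n by (simp add: L_def out_def mod_Suc)
  have "even n \<or> (\<exists>i<n. L i \<noteq> L (Suc i)) \<or> (\<exists>i<n. 3 \<le> card (L i))"
  proof (rule ccontr)
    assume neg: "\<not> ?thesis"
    hence K: "K = 4" and size3: "\<And>l. l < n \<Longrightarrow> block_size I (B l) = 3" using good by auto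
    have LS: "L (Suc i) = L i" if "i < n" for i using neg that by auto
    have L0: "L i = L 0" if "i \<le> n" for i
      using that
    proof (induction i)
      case (Suc i)
      thus ?case using LS[of i] by simp
    qed simp
    define C where "C = {..<K} - L 0"
    have C: "out i \<union> out (Suc i) = C" if "i < n" for i
      using L0[of i] that out[of i] out[of "Suc i"] by (auto simp: C_def L_def)
    have "0 < n" using n by simp
    hence "\<not> 3 \<le> card (L 0)" "2 \<le> card (L 0)" using neg cL[of 0] by blast+
    hence "card (L 0) = 2" by linarith
    moreover have "L 0 \<subseteq> {..<K}" by (auto simp: L_def)
    ultimately have cC: "card C = 2" using K unfolding C_def by (simp add: card_Diff_subset finite_subset)
    have le1: "card (out l) \<le> 1" if "l \<le> n" for l
      using card_out[OF that] size3[of l] size3[of 0] that wrap n by (cases "l = n") auto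
    \<comment> \<open>Two adjacent sets of at most one colour cover the two-element
      \<open>C\<close>, so each is a singleton and neighbours differ.\<close>
    have eq1: "card (out l) = 1" if "l < n" for l
      using card_Un_le[of "out l" "out (Suc l)"] C[OF that] cC le1[of l] le1[of "Suc l"] that by simp
    obtain x y where xy: "C = {x, y}" using cC by (auto simp: card_2_iff)
    have out_n: "out n = out 0" by (simp add: out_def)
    have "out l \<in> {{x}, {y}}" if l: "l < n" for l
    proof -
      obtain r where r: "out l = {r}" using eq1[OF l] by (auto simp: card_1_singleton_iff)
      hence "r \<in> C" using C[OF l] by auto
      thus ?thesis using r xy by auto
    qed
    hence vals: "out l \<in> {{x}, {y}}" if "l \<le> n" for l
      using that out_n n by (cases "l = n") (metis less_le_trans pos2, simp)
    have alt: "out i \<noteq> out (Suc i)" if "i < n" for i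
      using C[OF that] cC eq1[OF that] by auto
    have "even n" by (rule alternating_cycle_even[of out, OF out_n alt vals])
    thus False using neg by simp
  qed
  then obtain f where f: "\<forall>i<n. f i \<in> L i" "\<forall>i. Suc i < n \<longrightarrow> f i \<noteq> f (Suc i)" "f (n - 1) \<noteq> f 0"
    using cycle_list_coloring[OF n cL per] by blast
  have "f l < K \<and> f l \<notin> c ` (I\<inverse> `` {B l} - u ` {..<n}) \<and> f l \<notin> c ` (I\<inverse> `` {B (Suc l)} - u ` {..<n})"
    if "l < n" for l
  proof -
    have "f l \<in> L l" using f(1) that by blast
    hence "f l < K" "f l \<notin> out l" "f l \<notin> out (Suc l)" by (simp_all add: L_def)
    thus ?thesis using Bmod[of l] Bmod[of "Suc l"] that unfolding out_def by simp
  qed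
  with f(2,3) show "\<exists>f. (\<forall>l<n. f l < K \<and>
        f l \<notin> c ` (I\<inverse> `` {B l} - u ` {..<n}) \<and> f l \<notin> c ` (I\<inverse> `` {B (Suc l)} - u ` {..<n})) \<and>
        (\<forall>l. Suc l < n \<longrightarrow> f l \<noteq> f (Suc l)) \<and> f (n - 1) \<noteq> f 0"
    by (intro exI[of _ f]) simp
qed

section \<open>Density of critical relations by local counting\<close>

text \<open>A point in a single block of size at most \<open>K\<close> has at most
  \<open>K - 1\<close> conflicts.\<close>

lemma point_degree_ge_2:
  assumes "p \<in> Domain I" and "\<And>q. block_size I q \<le> K"
  shows "2 \<le> point_degree I p"
proof (rule ccontr)
  assume "\<not> ?thesis"
  moreover have "I `` {p} \<noteq> {}" using assms by auto
  hence "point_degree I p \<noteq> 0" by (simp add: point_degree_def)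
  ultimately have d: "card (I `` {p}) = 1" unfolding point_degree_def by linarith
  then obtain q where "I `` {p} = {q}" by (auto simp: card_1_singleton_iff)
  thus False using sum_block_sizes_ge[OF assms(1)] assms(2)[of q] d by (simp add: point_degree_def)
qed

lemma nonempty: assumes "0 < K" shows "I \<noteq> {}"
proof
  assume "I = {}"
  hence "point_coloring I K (\<lambda>_. 0)" using assms by (simp add: point_coloring_def)
  thus False using not_colorable by blast
qed

text \<open>Each block spreads weight 1 evenly over its points.\<close>

lemma sum_inverse_block_sizes:
  "(\<Sum>p\<in>Domain I. \<Sum>q\<in>I `` {p}. 1 / real (block_size I q)) = real (card (Range I))"
proof -
  have "(\<Sum>p\<in>Domain I. \<Sum>q\<in>I `` {p}. 1 / real (block_size I q)) =
      (\<Sum>p\<in>Domain I. \<Sum>q\<in>{q \<in> Range I. (p, q) \<in> I}. 1 / real (block_size I q))"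
    by (intro sum.cong) auto
  also have "\<dots> = (\<Sum>q\<in>Range I. \<Sum>p\<in>{p \<in> Domain I. (p, q) \<in> I}. 1 / real (block_size I q))"
    by (rule sum.swap_restrict) auto
  also have "\<dots> = (\<Sum>q\<in>Range I. 1)"
  proof (rule sum.cong)
    fix q assume "q \<in> Range I"
    hence "I\<inverse> `` {q} \<noteq> {}" by auto
    moreover have "{p \<in> Domain I. (p, q) \<in> I} = I\<inverse> `` {q}" by auto
    ultimately show "(\<Sum>p\<in>{p \<in> Domain I. (p, q) \<in> I}. 1 / real (block_size I q)) = 1"
      by (simp add: block_size_def)
  qed simp
  finally show ?thesis by simp
qed

text \<open>A discharging step: the charge \<open>b\<close> of every block is paid in equal parts by
  its points, which reduces a global density bound to an inequality at each point.\<close>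

lemma density_from_points:
  fixes a b :: real
  assumes "I \<noteq> {}"
    and pt: "\<And>p. p \<in> Domain I \<Longrightarrow>
      b + b * (\<Sum>q\<in>I `` {p}. 1 / real (block_size I q)) < a * real (point_degree I p)"
  shows "b * (real (card (Domain I)) + real (card (Range I))) < a * real (card I)"
proof -
  have "(\<Sum>p\<in>Domain I. b + b * (\<Sum>q\<in>I `` {p}. 1 / real (block_size I q)))
      < (\<Sum>p\<in>Domain I. a * real (point_degree I p))"
    using pt assms(1) by (intro sum_strict_mono) auto
  also have "\<dots> = a * real (card I)"
    using card_relation_points[OF finite_I finite_points] by (simp add: sum_distrib_left point_degree_def)
  also have "(\<Sum>p\<in>Domain I. b + b * (\<Sum>q\<in>I `` {p}. 1 / real (block_size I q))) =
      b * (real (card (Domain I)) + (\<Sum>p\<in>Domain I. \<Sum>q\<in>I `` {p}. 1 / real (block_size I q)))"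
    by (simp add: sum.distrib sum_distrib_left distrib_left mult.commute)
  finally show ?thesis by (simp add: sum_inverse_block_sizes)
qed

lemma inverse_block_size_le:
  assumes "numeral m \<le> block_size I q" shows "1 / real (block_size I q) \<le> 1 / numeral m"
proof -
  have "real (numeral m) \<le> real (block_size I q)" using assms by (rule of_nat_mono)
  thus ?thesis by (intro frac_le) simp_all
qed

lemma sum_inverse_le_half:
  "(\<Sum>q\<in>I `` {p}. 1 / real (block_size I q)) \<le> real (point_degree I p) / 2"
proof -
  have "(\<Sum>q\<in>I `` {p}. 1 / real (block_size I q)) \<le> (\<Sum>q\<in>I `` {p}. 1 / 2)"
  proof (rule sum_mono)
    fix q assume "q \<in> I `` {p}"
    hence "2 \<le> block_size I q" using block_size_ge_2 by auto
    thus "1 / real (block_size I q) \<le> 1 / 2" by (rule inverse_block_size_le)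
  qed
  thus ?thesis by (simp add: point_degree_def)
qed

text \<open>Degree 2: sizes with sum at least 6 have reciprocals with sum at most 1/2 + 1/4, and 21
  (1 + 3/4) < 38. Degree d \<ge> 3: each reciprocal is at most 1/2, and 21 + 21 d/2 < 19 d.\<close>

lemma density_gt_42_19_large_degree:
  assumes k: "4 \<le> K" and dQ: "\<And>q. block_size I q \<le> K"
  shows "21 * (real (card (Domain I)) + real (card (Range I))) < 19 * real (card I)"
proof (rule density_from_points)
  show "I \<noteq> {}" using nonempty k by simp
  fix p assume p: "p \<in> Domain I"
  let ?S = "\<Sum>q\<in>I `` {p}. 1 / real (block_size I q)"
  show "21 + 21 * ?S < 19 * real (point_degree I p)"
  proof (cases "point_degree I p = 2")
    case True
    then obtain q r where qr: "I `` {p} = {q, r}" "q \<noteq> r" by (auto simp: point_degree_def card_2_iff)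
    have sum: "6 \<le> block_size I q + block_size I r"
      using sum_block_sizes_ge[OF p] True qr k by simp
    have "q \<in> I `` {p}" "r \<in> I `` {p}" using qr by auto
    hence ge2: "2 \<le> block_size I q" "2 \<le> block_size I r" using block_size_ge_2 by auto
    consider "4 \<le> block_size I q" | "4 \<le> block_size I r" | "3 \<le> block_size I q" "3 \<le> block_size I r"
      using sum by linarith
    hence "1 / real (block_size I q) + 1 / real (block_size I r) \<le> 3 / 4"
    proof cases
      case 1
      thus ?thesis using inverse_block_size_le[OF 1] inverse_block_size_le[OF ge2(2)] by linarith
    next
      case 2
      thus ?thesis using inverse_block_size_le[OF 2] inverse_block_size_le[OF ge2(1)] by linarith
    next
      case 3
      thus ?thesis using inverse_block_size_le[OF 3(1)] inverse_block_size_le[OF 3(2)] by linarith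
    qed
    thus ?thesis using True qr by simp
  next
    case False
    hence "3 \<le> point_degree I p" using point_degree_ge_2[OF p dQ] by simp
    thus ?thesis using sum_inverse_le_half[of p] by simp
  qed
qed

text \<open>Degree 2: both sizes are at least 3 and one is at least 4, and 5 (1 + 7/12) < 8. Degree
  3: three blocks of size 2 would weigh too much, but the sizes add up to at least 8, so one is at
  least 3, and 5 (1 + 4/3) < 12. Degree d \<ge> 4: 5 + 5 d/2 < 4 d.\<close>

lemma density_gt_5_2_large_degree:
  assumes k: "5 \<le> K" and dQ: "\<And>q. block_size I q < K"
  shows "5 * (real (card (Domain I)) + real (card (Range I))) < 4 * real (card I)"
proof (rule density_from_points)
  show "I \<noteq> {}" using nonempty k by simp
  fix p assume p: "p \<in> Domain I"
  let ?S = "\<Sum>q\<in>I `` {p}. 1 / real (block_size I q)"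
  have "2 \<le> point_degree I p" using point_degree_ge_2[OF p] dQ by (simp add: less_imp_le)
  then consider "point_degree I p = 2" | "point_degree I p = 3" | "4 \<le> point_degree I p" by linarith
  thus "5 + 5 * ?S < 4 * real (point_degree I p)"
  proof cases
    case 1
    then obtain q r where qr: "I `` {p} = {q, r}" "q \<noteq> r" by (auto simp: point_degree_def card_2_iff)
    have sum: "K + 2 \<le> block_size I q + block_size I r"
      using sum_block_sizes_ge[OF p] 1 qr by simp
    hence ge3: "3 \<le> block_size I q" "3 \<le> block_size I r" using dQ[of q] dQ[of r] by linarith+
    have "4 \<le> block_size I q \<or> 4 \<le> block_size I r" using sum k by linarith
    hence "1 / real (block_size I q) + 1 / real (block_size I r) \<le> 7 / 12"
    proof
      assume 4: "4 \<le> block_size I q"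
      show ?thesis using inverse_block_size_le[OF ge3(2)] inverse_block_size_le[OF 4] by linarith
    next
      assume 4: "4 \<le> block_size I r"
      show ?thesis using inverse_block_size_le[OF ge3(1)] inverse_block_size_le[OF 4] by linarith
    qed
    thus ?thesis using 1 qr by simp
  next
    case 2
    have "\<exists>q\<in>I `` {p}. 3 \<le> block_size I q"
    proof (rule ccontr)
      assume "\<not> ?thesis"
      hence "block_size I q \<le> 2" if "q \<in> I `` {p}" for q using that by (metis not_less_eq_eq numeral_2_eq_2 numeral_3_eq_3)
      hence "(\<Sum>q\<in>I `` {p}. block_size I q) \<le> (\<Sum>q\<in>I `` {p}. 2)" by (rule sum_mono)
      thus False using sum_block_sizes_ge[OF p] 2 k by (simp add: point_degree_def)
    qed
    then obtain q where q: "q \<in> I `` {p}" "3 \<le> block_size I q" by blast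
    have "?S = 1 / real (block_size I q) + (\<Sum>q\<in>I `` {p} - {q}. 1 / real (block_size I q))"
      using q by (intro sum.remove) auto
    also have "(\<Sum>q\<in>I `` {p} - {q}. 1 / real (block_size I q)) \<le> (\<Sum>q\<in>I `` {p} - {q}. 1 / 2)"
    proof (rule sum_mono)
      fix r assume "r \<in> I `` {p} - {q}"
      hence "2 \<le> block_size I r" using block_size_ge_2 by auto
      thus "1 / real (block_size I r) \<le> 1 / 2" by (rule inverse_block_size_le)
    qed
    also have "(\<Sum>q\<in>I `` {p} - {q}. 1 / 2) = (1 :: real)" using 2 q by (simp add: point_degree_def)
    finally show ?thesis using 2 inverse_block_size_le[OF q(2)] by linarith
  next
    case 3
    thus ?thesis using sum_inverse_le_half[of p] by simp
  qed
qed

lemma card_points_degree: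
  "card {e \<in> I. point_degree I (fst e) = d} = d * card {p \<in> Domain I. point_degree I p = d}"
proof -
  let ?D = "{p \<in> Domain I. point_degree I p = d}"
  have "card {e \<in> I. point_degree I (fst e) = d} = (\<Sum>p\<in>?D. card ({e \<in> I. point_degree I (fst e) = d} `` {p}))"
    using finite_I by (intro card_relation_points) auto
  also have "\<dots> = (\<Sum>p\<in>?D. d)"
  proof (rule sum.cong)
    fix p assume p: "p \<in> ?D"
    hence "{e \<in> I. point_degree I (fst e) = d} `` {p} = I `` {p}" by auto
    thus "card ({e \<in> I. point_degree I (fst e) = d} `` {p}) = d" using p by (simp add: point_degree_def)
  qed simp
  finally show ?thesis by simp
qed

lemma card_blocks_size:
  "card {e \<in> I. block_size I (snd e) = d} = d * card {q \<in> Range I. block_size I q = d}"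
proof -
  let ?D = "{q \<in> Range I. block_size I q = d}"
  have "card {e \<in> I. block_size I (snd e) = d} = (\<Sum>q\<in>?D. card ({e \<in> I. block_size I (snd e) = d}\<inverse> `` {q}))"
    using finite_I by (intro card_relation_blocks) auto
  also have "\<dots> = (\<Sum>q\<in>?D. d)"
  proof (rule sum.cong)
    fix q assume q: "q \<in> ?D"
    hence "{e \<in> I. block_size I (snd e) = d}\<inverse> `` {q} = I\<inverse> `` {q}" by auto
    thus "card ({e \<in> I. block_size I (snd e) = d}\<inverse> `` {q}) = d" using q by (simp add: block_size_def)
  qed simp
  finally show ?thesis by simp
qed

end

section \<open>Critical relations of maximum degree 3\<close>

text \<open>Used with \<open>K = 4\<close> for the bound 5/2 and with \<open>K = 3\<close> for
  42/19. The local count fails here at points of degree 2: 5 (1 + 2/3) > 8 and 21 (1 + 5/6) >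
  38.\<close>

locale subcubic_critical = critical +
  assumes K3: "3 \<le> K" and point_degree_le_3: "\<And>p. point_degree I p \<le> 3"
    and block_size_le_3: "\<And>q. block_size I q \<le> 3"
begin

definition "P d = {p \<in> Domain I. point_degree I p = d}"
definition "Q d = {q \<in> Range I. block_size I q = d}"
definition "E d e = {x \<in> I. point_degree I (fst x) = d \<and> block_size I (snd x) = e}"

lemma finite_classes [simp]: "finite (P d)" "finite (Q d)" "finite (E d e)"
  using finite_I by (simp_all add: P_def Q_def E_def)

lemma point_degree_cases: assumes "p \<in> Domain I" shows "point_degree I p = 2 \<or> point_degree I p = 3"
proof -
  have "block_size I q \<le> K" for q using block_size_le_3[of q] K3 by simp
  hence "2 \<le> point_degree I p" by (rule point_degree_ge_2[OF assms])
  thus ?thesis using point_degree_le_3[of p] by linarith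
qed

lemma block_size_cases: assumes "q \<in> Range I" shows "block_size I q = 2 \<or> block_size I q = 3"
  using block_size_ge_2[OF assms] block_size_le_3[of q] by linarith

text \<open>Double counts of the incidences by class; the density arguments below are linear
  arithmetic over these equations.\<close>

lemma card_E:
  "card (E 2 2) + card (E 2 3) = 2 * card (P 2)" "card (E 3 2) + card (E 3 3) = 3 * card (P 3)"
  "card (E 2 2) + card (E 3 2) = 2 * card (Q 2)" "card (E 2 3) + card (E 3 3) = 3 * card (Q 3)"
  "card I = 2 * card (P 2) + 3 * card (P 3)" "card I = 2 * card (Q 2) + 3 * card (Q 3)"
  "card (Domain I) = card (P 2) + card (P 3)" "card (Range I) = card (Q 2) + card (Q 3)"
proof -
  have pc: "point_degree I (fst x) = 2 \<or> point_degree I (fst x) = 3"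
    and bc: "block_size I (snd x) = 2 \<or> block_size I (snd x) = 3" if "x \<in> I" for x
    using that point_degree_cases[of "fst x"] block_size_cases[of "snd x"] by (cases x; force)+
  have union: "card (E d 2) + card (E d 3) = card {x \<in> I. point_degree I (fst x) = d}" for d
    using bc finite_I by (subst card_Un_disjoint[symmetric]) (auto simp: E_def intro!: arg_cong[of _ _ card])
  have union': "card (E 2 d) + card (E 3 d) = card {x \<in> I. block_size I (snd x) = d}" for d
    using pc finite_I by (subst card_Un_disjoint[symmetric]) (auto simp: E_def intro!: arg_cong[of _ _ card])
  show "card (E 2 2) + card (E 2 3) = 2 * card (P 2)" "card (E 3 2) + card (E 3 3) = 3 * card (P 3)"
    using union card_points_degree by (simp_all add: P_def)
  show "card (E 2 2) + card (E 3 2) = 2 * card (Q 2)" "card (E 2 3) + card (E 3 3) = 3 * card (Q 3)"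
    using union' card_blocks_size by (simp_all add: Q_def)
  have "card I = card {x \<in> I. point_degree I (fst x) = 2} + card {x \<in> I. point_degree I (fst x) = 3}"
    using pc finite_I by (subst card_Un_disjoint[symmetric]) (auto intro!: arg_cong[of _ _ card])
  thus "card I = 2 * card (P 2) + 3 * card (P 3)" using card_points_degree by (simp add: P_def)
  have "card I = card {x \<in> I. block_size I (snd x) = 2} + card {x \<in> I. block_size I (snd x) = 3}"
    using bc finite_I by (subst card_Un_disjoint[symmetric]) (auto intro!: arg_cong[of _ _ card])
  thus "card I = 2 * card (Q 2) + 3 * card (Q 3)" using card_blocks_size by (simp add: Q_def)
  have "Domain I = P 2 \<union> P 3" using point_degree_cases by (auto simp: P_def)
  moreover have "P 2 \<inter> P 3 = {}" by (auto simp: P_def)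
  ultimately show "card (Domain I) = card (P 2) + card (P 3)" by (simp add: card_Un_disjoint)
  have "Range I = Q 2 \<union> Q 3" using block_size_cases by (auto simp: Q_def)
  moreover have "Q 2 \<inter> Q 3 = {}" by (auto simp: Q_def)
  ultimately show "card (Range I) = card (Q 2) + card (Q 3)" by (simp add: card_Un_disjoint)
qed

text \<open>With sizes at most 3, this makes both blocks have size 3 if \<open>K = 4\<close>, and at
  least one of them if \<open>K = 3\<close>.\<close>

lemma two_point_blocks:
  assumes "p \<in> P 2" "q \<in> I `` {p}"
  shows "\<exists>r. r \<noteq> q \<and> I `` {p} = {q, r} \<and> K + 2 \<le> block_size I q + block_size I r"
proof -
  have p: "p \<in> Domain I" "point_degree I p = 2" using assms by (auto simp: P_def)
  then obtain r where "r \<noteq> q" "I `` {p} = {q, r}"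
    using card_two_cases[of "I `` {p}" q] assms(2) by (auto simp: point_degree_def)
  thus ?thesis using sum_block_sizes_ge[OF p(1)] p(2) by auto
qed

text \<open>Points of degree 2 join blocks of size 3. In a sparse relation they would be at least as
  many as these blocks and so contain a cycle, which \<open>no_two_point_cycle\<close> excludes for
  either parity.\<close>

lemma density_gt_5_2_subcubic:
  assumes K: "K = 4"
  shows "5 * (card (Domain I) + card (Range I)) < 4 * card I"
proof (rule ccontr)
  assume "\<not> ?thesis"
  hence sparse: "4 * card I \<le> 5 * card (Domain I) + 5 * card (Range I)" by simp
  have P2: "I `` {p} \<subseteq> Q 3" if p: "p \<in> P 2" for p
  proof
    fix q assume q: "q \<in> I `` {p}"
    then obtain r where "K + 2 \<le> block_size I q + block_size I r" using two_point_blocks[OF p] by blast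
    thus "q \<in> Q 3" using K q block_size_le_3[of q] block_size_le_3[of r] by (auto simp: Q_def)
  qed
  hence "E 2 2 = {}" by (fastforce simp: E_def P_def Q_def)
  hence E22: "card (E 2 2) = 0" by simp
  \<comment> \<open>A point of degree 3 has at most two blocks of size 2: three would have total
    size 6, below \<open>K + 3\<close>.\<close>
  have "Domain (E 3 2) \<subseteq> P 3" by (auto simp: E_def P_def)
  hence "card (E 3 2) = (\<Sum>p\<in>P 3. card (E 3 2 `` {p}))"
    by (intro card_relation_points) simp_all
  also have "\<dots> \<le> (\<Sum>p\<in>P 3. 2)"
  proof (rule sum_mono)
    fix p assume p: "p \<in> P 3"
    hence d: "card (I `` {p}) = 3" "p \<in> Domain I" by (auto simp: P_def point_degree_def)
    have "E 3 2 `` {p} \<noteq> I `` {p}"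
    proof
      assume eq: "E 3 2 `` {p} = I `` {p}"
      have "block_size I q = 2" if "q \<in> I `` {p}" for q
        using that unfolding eq[symmetric] by (auto simp: E_def)
      hence "(\<Sum>q\<in>I `` {p}. block_size I q) = 6" using d by simp
      thus False using sum_block_sizes_ge[OF d(2)] d K by (simp add: point_degree_def)
    qed
    moreover have "E 3 2 `` {p} \<subseteq> I `` {p}" by (auto simp: E_def)
    ultimately have "card (E 3 2 `` {p}) < card (I `` {p})" by (intro psubset_card_mono) auto
    thus "card (E 3 2 `` {p}) \<le> 2" using d by simp
  qed
  finally have "card (E 3 2) \<le> 2 * card (P 3)" by simp
  \<comment> \<open>\<open>sparse\<close> amounts to
    \<open>card (P 3) + card (Q 3) \<le> card (P 2) + card (Q 2)\<close>, and
    \<open>card (Q 2) \<le> card (P 3)\<close> because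
    \<open>card (E 3 2) = 2 * card (Q 2)\<close>.\<close>
  hence le: "card (Q 3) \<le> card (P 2)" using card_E sparse E22 by linarith
  \<comment> \<open>Otherwise \<open>Q 3\<close> is empty too, and 3 \<open>card (P 3)\<close> = 2
    \<open>card (Q 2)\<close> \<le> 2 \<open>card (P 3)\<close> leaves no incidence.\<close>
  have "P 2 \<noteq> {}"
  proof
    assume "P 2 = {}"
    hence "card (P 2) = 0" by simp
    hence "card I = 0" using card_E le \<open>card (E 3 2) \<le> 2 * card (P 3)\<close> by linarith
    thus False using finite_I nonempty K3 by simp
  qed
  moreover have "card (I `` {p}) = 2" if "p \<in> P 2" for p using that by (simp add: P_def point_degree_def)
  ultimately obtain n u B where cyc: "two_point_cycle I n u B" and u: "u ` {..<n} \<subseteq> P 2"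
    using exists_two_point_cycle[of "P 2" "Q 3" I] le P2 by auto
  have B: "block_size I (B l) = 3" "block_size I (B (Suc l)) = 3" if "l < n" for l
  proof -
    have "u l \<in> P 2" using u that by auto
    hence "{B l, B (Suc l)} \<subseteq> Q 3" using P2[of "u l"] cyc that by (simp add: two_point_cycle_def)
    thus "block_size I (B l) = 3" "block_size I (B (Suc l)) = 3" by (auto simp: Q_def)
  qed
  show False using no_two_point_cycle[OF cyc] B K by simp
qed

text \<open>Take the blocks in \<open>T\<close> and \<open>Q 3\<close> as vertices and the points of
  blocks in \<open>T\<close> as edges. Sparsity gives more blocks in \<open>T\<close> than in
  \<open>Q 3\<close>, so the 2 \<open>card T\<close> edges force a cycle. Block sizes 2 and 3
  alternate along it, so it is even, and adjacent sizes add up to \<open>K + 2\<close>.\<close>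

lemma density_ge_42_19_subcubic:
  assumes K: "K = 3"
  shows "21 * (card (Domain I) + card (Range I)) \<le> 19 * card I"
proof (rule ccontr)
  assume "\<not> ?thesis"
  hence sparse: "19 * card I < 21 * card (Domain I) + 21 * card (Range I)" by simp
  \<comment> \<open>A block in \<open>T\<close> is the middle of a path of three degree-2 vertices joining two blocks of size 3.\<close>
  define T where "T = {q \<in> Q 2. I\<inverse> `` {q} \<subseteq> P 2}"
  define A where "A = (\<Union>q\<in>T. I\<inverse> `` {q})"
  have finT: "finite T" by (simp add: T_def)
  have other: "\<exists>r. r \<noteq> q \<and> I `` {p} = {q, r} \<and> r \<in> Q 3" if p: "p \<in> P 2" "q \<in> Q 2" "(p, q) \<in> I" for p q
  proof -
    obtain r where r: "r \<noteq> q" "I `` {p} = {q, r}" "K + 2 \<le> block_size I q + block_size I r"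
      using two_point_blocks[of p q] p by auto
    have "r \<in> Range I" using r(2) by blast
    hence "r \<in> Q 3" using r(3) p(2) K block_size_le_3[of r] by (simp add: Q_def)
    thus ?thesis using r by blast
  qed
  \<comment> \<open>By \<open>other\<close>, a point of degree 2 lies in at most one block of size
    2.\<close>
  have "Domain (E 2 2) \<subseteq> P 2" by (auto simp: E_def P_def)
  hence "card (E 2 2) = (\<Sum>p\<in>P 2. card (E 2 2 `` {p}))"
    by (intro card_relation_points) simp_all
  also have "\<dots> \<le> (\<Sum>p\<in>P 2. 1)"
  proof (rule sum_mono)
    fix p assume p: "p \<in> P 2"
    show "card (E 2 2 `` {p}) \<le> 1"
    proof (cases "E 2 2 `` {p} = {}")
      case False
      then obtain q where q: "(p, q) \<in> E 2 2" by blast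
      hence qI: "q \<in> Q 2" "(p, q) \<in> I" by (auto simp: E_def Q_def)
      obtain r where "I `` {p} = {q, r}" "r \<in> Q 3" using other[OF p qI] by blast
      hence "E 2 2 `` {p} \<subseteq> {q}" by (auto simp: E_def Q_def)
      hence "card (E 2 2 `` {p}) \<le> card {q}" by (intro card_mono) auto
      thus ?thesis by simp
    qed simp
  qed
  finally have le1: "card (E 2 2) \<le> card (P 2)" by simp
  \<comment> \<open>A block of size 2 outside \<open>T\<close> contains a point of degree 3.\<close>
  have "Q 2 - T \<subseteq> snd ` E 3 2"
  proof
    fix q assume q: "q \<in> Q 2 - T"
    then obtain p where p: "(p, q) \<in> I" "p \<notin> P 2" by (auto simp: T_def)
    hence "point_degree I p = 3" using point_degree_cases[of p] by (auto simp: P_def)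
    hence "(p, q) \<in> E 3 2" using p q by (auto simp: E_def Q_def)
    thus "q \<in> snd ` E 3 2" by force
  qed
  hence "card (Q 2 - T) \<le> card (snd ` E 3 2)" by (intro card_mono) auto
  also have "\<dots> \<le> card (E 3 2)" by (intro card_image_le) simp
  finally have "card (Q 2 - T) \<le> card (E 3 2)" .
  moreover have "card (Q 2 - T) = card (Q 2) - card T" using finT by (intro card_Diff_subset) (auto simp: T_def)
  ultimately have "card (Q 2) \<le> card T + card (E 3 2)" by simp
  \<comment> \<open>Write eij for \<open>card (E i j)\<close>. Then \<open>sparse\<close> reads 4
    e22 > 3 e23 + 3 e32 + 10 e33 and \<open>le1\<close> reads e22 \<le> e23. Subtracting gives 3
    (e22 - e32) > 2 (e23 + e33), which says that \<open>card (Q 2)\<close> exceeds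
    \<open>card (Q 3) + card (E 3 2)\<close>. This is where 42/19 enters.\<close>
  hence lt: "card (Q 3) < card T" using card_E sparse le1 by linarith
  have AD: "a \<in> P 2 \<and> (\<exists>q r. q \<in> T \<and> r \<in> Q 3 \<and> I `` {a} = {q, r} \<and> q \<noteq> r)" if a: "a \<in> A" for a
  proof -
    obtain q where q: "q \<in> T" "(a, q) \<in> I" using a by (auto simp: A_def)
    hence "a \<in> P 2" "q \<in> Q 2" by (auto simp: T_def)
    thus ?thesis using other[of a q] q by blast
  qed
  have disj: "T \<inter> Q 3 = {}" by (auto simp: T_def Q_def)
  \<comment> \<open>Blocks in \<open>T\<close> share no point, because the other block of such a
    point has size 3.\<close>
  have "card A = (\<Sum>q\<in>T. card (I\<inverse> `` {q}))"
    unfolding A_def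
  proof (rule card_UN_disjoint)
    show "\<forall>q\<in>T. \<forall>r\<in>T. q \<noteq> r \<longrightarrow> I\<inverse> `` {q} \<inter> I\<inverse> `` {r} = {}"
    proof (intro ballI impI)
      fix q r assume qr: "q \<in> T" "r \<in> T" "q \<noteq> r"
      show "I\<inverse> `` {q} \<inter> I\<inverse> `` {r} = {}"
      proof (rule ccontr)
        assume "\<not> ?thesis"
        then obtain a where a: "(a, q) \<in> I" "(a, r) \<in> I" by auto
        hence "a \<in> A" using qr by (auto simp: A_def)
        then obtain s t where st: "t \<in> Q 3" "I `` {a} = {s, t}" using AD by blast
        have "q \<in> {s, t}" "r \<in> {s, t}" using a unfolding st(2)[symmetric] by auto
        thus False using qr st(1) disj by auto
      qed
    qed
  qed (use finT in auto)
  also have "\<dots> = (\<Sum>q\<in>T. 2)" by (intro sum.cong) (auto simp: T_def Q_def block_size_def)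
  finally have cA: "card A = 2 * card T" by simp
  have "card (T \<union> Q 3) \<le> card A" using card_Un_le[of T "Q 3"] cA lt by simp
  moreover have "A \<noteq> {}" using cA lt by auto
  moreover have "finite A" using finT by (simp add: A_def)
  moreover have "card (I `` {a}) = 2" "I `` {a} \<subseteq> T \<union> Q 3" if a: "a \<in> A" for a
  proof -
    obtain q r where "q \<in> T" "r \<in> Q 3" "I `` {a} = {q, r}" "q \<noteq> r" using AD[OF a] by blast
    thus "card (I `` {a}) = 2" "I `` {a} \<subseteq> T \<union> Q 3" by simp_all
  qed
  ultimately obtain n u B where cyc: "two_point_cycle I n u B" and u: "u ` {..<n} \<subseteq> A"
    using exists_two_point_cycle[of A "T \<union> Q 3" I] finT by auto
  have B: "{block_size I (B l), block_size I (B (Suc l))} = {2, 3}" if "l < n" for l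
  proof -
    have "u l \<in> A" using u that by auto
    then obtain q r where "q \<in> T" "r \<in> Q 3" "I `` {u l} = {q, r}" using AD by blast
    moreover have "I `` {u l} = {B l, B (Suc l)}" using cyc that by (simp add: two_point_cycle_def)
    ultimately have "block_size I ` {B l, B (Suc l)} = block_size I ` {q, r}"
      "block_size I q = 2" "block_size I r = 3" by (auto simp: T_def Q_def)
    thus ?thesis by simp
  qed
  have n: "2 \<le> n" "B n = B 0" using cyc by (auto simp: two_point_cycle_def)
  have vals: "block_size I (B l) \<in> {2, 3}" if "l \<le> n" for l
    using B[of l] B[of 0] that n by (cases "l = n") auto
  have "even n"
  proof (rule alternating_cycle_even[of "\<lambda>l. block_size I (B l)"])
    show "block_size I (B l) \<noteq> block_size I (B (Suc l))" if "l < n" for l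
      using B[OF that] by (auto simp: doubleton_eq_iff)
  qed (use n vals in auto)
  moreover have "block_size I (B l) + block_size I (B (Suc l)) \<le> K + 2" if "l < n" for l
    using B[OF that] K by (auto simp: doubleton_eq_iff)
  ultimately show False using no_two_point_cycle[OF cyc] by blast
qed

end


section \<open>Sparse relations are colourable\<close>

lemma critical_subset:
  assumes "finite I" "\<not> (\<exists>c. point_coloring I K c)"
  shows "\<exists>J\<subseteq>I. critical J K"
  using assms
proof (induction I rule: finite_psubset_induct)
  case (psubset I)
  show ?case
  proof (cases "\<exists>J\<subset>I. \<not> (\<exists>c. point_coloring J K c)")
    case True
    thus ?thesis using psubset.IH by (meson psubset_imp_subset subset_trans)
  next
    case False
    hence "critical I K" using psubset by unfold_locales auto
    thus ?thesis by blast
  qed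
qed

lemma point_degree_mono: "finite I \<Longrightarrow> J \<subseteq> I \<Longrightarrow> point_degree J p \<le> point_degree I p"
  unfolding point_degree_def by (intro card_mono finite_Image) auto

lemma block_size_mono: "finite I \<Longrightarrow> J \<subseteq> I \<Longrightarrow> block_size J q \<le> block_size I q"
  unfolding block_size_def by (intro card_mono finite_Image) auto

lemma point_colorable_sparse_5_2:
  assumes fin: "finite I" and dP: "\<And>p. point_degree I p \<le> k" and dQ: "\<And>q. block_size I q \<le> k"
    and sparse: "\<And>J. J \<subseteq> I \<Longrightarrow> 4 * card J \<le> 5 * (card (Domain J) + card (Range J))"
  shows "\<exists>c. point_coloring I (k + 1) c"
proof (rule ccontr)
  assume "\<not> ?thesis"
  then obtain J where J: "J \<subseteq> I" "critical J (k + 1)" using critical_subset[OF fin] by blast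
  interpret critical J "k + 1" by (rule J)
  have dP': "point_degree J p \<le> k" for p using point_degree_mono[OF fin J(1), of p] dP[of p] by simp
  have dQ': "block_size J q \<le> k" for q using block_size_mono[OF fin J(1), of q] dQ[of q] by simp
  have sp: "4 * card J \<le> 5 * (card (Domain J) + card (Range J))" by (rule sparse[OF J(1)])
  consider "k \<le> 2" | "k = 3" | "4 \<le> k" by linarith
  thus False
  proof cases
    case 1
    obtain p where p: "p \<in> Domain J" using nonempty by auto
    have "block_size J q \<le> k + 1" for q using dQ'[of q] by simp
    hence ge: "2 \<le> point_degree J p" by (rule point_degree_ge_2[OF p])
    hence 2: "point_degree J p = 2" "k = 2" using dP'[of p] 1 by simp_all
    \<comment> \<open>Two blocks of size at most 2 have total size at most 4, below
      \<open>(k + 1) + 2 = 5\<close>.\<close>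
    have "(\<Sum>q\<in>J `` {p}. block_size J q) \<le> (\<Sum>q\<in>J `` {p}. k)" by (intro sum_mono dQ')
    also have "\<dots> = 4" using 2 by (simp add: point_degree_def)
    finally show False using sum_block_sizes_ge[OF p] 2 by simp
  next
    case 2
    interpret subcubic_critical J "k + 1" by unfold_locales (use 2 dP' dQ' in auto)
    show False using density_gt_5_2_subcubic 2 sp by simp
  next
    case 3
    have "5 * (real (card (Domain J)) + real (card (Range J))) < 4 * real (card J)"
      using density_gt_5_2_large_degree 3 dQ' by (simp add: less_Suc_eq_le)
    hence "real (5 * (card (Domain J) + card (Range J))) < real (4 * card J)" by simp
    thus False using sp unfolding of_nat_less_iff by simp
  qed
qed

text \<open>For \<open>k = 2\<close> the conclusion fails: the double cover of a triangle needs
  three colours. The strict inequality is false for the empty relation, hence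
  \<open>J \<noteq> {}\<close>.\<close>

lemma point_colorable_sparse_42_19:
  assumes fin: "finite I" and dP: "\<And>p. point_degree I p \<le> k" and dQ: "\<And>q. block_size I q \<le> k"
    and sparse: "\<And>J. J \<subseteq> I \<Longrightarrow> J \<noteq> {} \<Longrightarrow> 19 * card J < 21 * (card (Domain J) + card (Range J))"
    and k: "3 \<le> k"
  shows "\<exists>c. point_coloring I k c"
proof (rule ccontr)
  assume "\<not> ?thesis"
  then obtain J where J: "J \<subseteq> I" "critical J k" using critical_subset[OF fin] by blast
  interpret critical J k by (rule J)
  have dP': "point_degree J p \<le> k" for p using point_degree_mono[OF fin J(1), of p] dP[of p] by simp
  have dQ': "block_size J q \<le> k" for q using block_size_mono[OF fin J(1), of q] dQ[of q] by simp
  have "J \<noteq> {}" using nonempty k by simp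
  hence sp: "19 * card J < 21 * (card (Domain J) + card (Range J))" by (rule sparse[OF J(1)])
  show False
  proof (cases "k = 3")
    case True
    interpret subcubic_critical J k by unfold_locales (use True dP' dQ' in auto)
    show False using density_ge_42_19_subcubic True sp by simp
  next
    case False
    have "21 * (real (card (Domain J)) + real (card (Range J))) < 19 * real (card J)"
      using density_gt_42_19_large_degree False k dQ' by simp
    hence "real (21 * (card (Domain J) + card (Range J))) < real (19 * card J)" by simp
    thus False using sp unfolding of_nat_less_iff by simp
  qed
qed

subsection \<open>The bipartite double cover of a graph\<close>

text \<open>The first component is the vertex as a point, the second the vertex as a block; every
  edge appears in both orientations.\<close>

definition double_cover :: "'a set set \<Rightarrow> ('a \<times> 'a) set" where
  "double_cover E = {(u, w). {u, w} \<in> E}"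

context
  fixes V :: "'a set" and E :: "'a set set"
  assumes G: "simple_graph V E"
begin

lemma edgeD: assumes "{u, w} \<in> E" shows "u \<in> V" "w \<in> V" "u \<noteq> w"
proof -
  have "{u, w} \<subseteq> V" "card {u, w} = 2" using G assms unfolding simple_graph_def by blast+
  thus "u \<in> V" "w \<in> V" "u \<noteq> w" by auto
qed

lemma finite_V: "finite V" and finite_E: "finite E"
proof -
  show "finite V" using G by (simp add: simple_graph_def)
  moreover have "E \<subseteq> Pow V" using G by (auto simp: simple_graph_def)
  ultimately show "finite E" by (meson finite_Pow_iff finite_subset)
qed

lemma double_cover_subset: "double_cover E \<subseteq> V \<times> V"
  using edgeD by (auto simp: double_cover_def)

lemma finite_double_cover: "finite (double_cover E)"
  using double_cover_subset finite_V by (meson finite_SigmaI finite_subset)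

lemma degree_le_max: assumes "v \<in> V" shows "degree E v \<le> max_degree V E"
  unfolding max_degree_def using finite_V assms by (intro Max_ge) auto

lemma card_neighbours_le: "card {u. {u, v} \<in> E} \<le> max_degree V E"
proof (cases "v \<in> V")
  case True
  thus ?thesis using degree_le_max by (simp add: degree_def)
next
  case False
  hence "{u. {u, v} \<in> E} = {}" using edgeD by blast
  thus ?thesis by simp
qed

lemma double_cover_point_degree: "point_degree (double_cover E) p \<le> max_degree V E"
proof -
  have "double_cover E `` {p} = {u. {u, p} \<in> E}" by (auto simp: double_cover_def insert_commute)
  thus ?thesis using card_neighbours_le by (simp add: point_degree_def)
qed

lemma double_cover_block_size: "block_size (double_cover E) q \<le> max_degree V E"
proof -
  have "(double_cover E)\<inverse> `` {q} = {u. {u, q} \<in> E}" by (auto simp: double_cover_def)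
  thus ?thesis using card_neighbours_le by (simp add: block_size_def)
qed

lemma avg_degree_le_mad:
  assumes "simple_graph W F" "W \<subseteq> V" "F \<subseteq> E" "W \<noteq> {}"
  shows "avg_degree W F \<le> mad V E"
proof -
  let ?S = "{avg_degree W F |W F. simple_graph W F \<and> W \<subseteq> V \<and> F \<subseteq> E \<and> W \<noteq> {}}"
  have "?S \<subseteq> (\<lambda>(W, F). avg_degree W F) ` (Pow V \<times> Pow E)" by force
  hence "finite ?S" using finite_V finite_E by (meson finite_Pow_iff finite_SigmaI finite_imageI finite_subset)
  moreover have "avg_degree W F \<in> ?S" using assms by blast
  ultimately show ?thesis unfolding mad_def by (intro Max_ge) auto
qed

lemma subgraph_edges_le:
  assumes "W \<subseteq> V" "F \<subseteq> E" "\<And>e. e \<in> F \<Longrightarrow> e \<subseteq> W" "W \<noteq> {}"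
  shows "2 * real (card F) \<le> mad V E * real (card W)"
proof -
  have fin: "finite W" using assms finite_V by (meson finite_subset)
  have "simple_graph W F" using G assms fin by (auto simp: simple_graph_def)
  hence "avg_degree W F \<le> mad V E" using avg_degree_le_mad assms by blast
  moreover have "0 < card W" using fin assms by (simp add: card_gt_0_iff)
  ultimately show ?thesis by (simp add: avg_degree_def divide_le_eq)
qed

text \<open>Edges used in both directions lie inside \<open>W \<inter> Y\<close> and are counted a second time there;
  this is why the double cover is as sparse as the graph.\<close>

lemma double_cover_sparse:
  assumes J: "J \<subseteq> double_cover E" "J \<noteq> {}"
  shows "2 * real (card J) \<le> mad V E * (real (card (Domain J)) + real (card (Range J)))"
proof -
  define W Y where "W = Domain J" and "Y = Range J"
  \<comment> \<open>\<open>F1\<close> holds the edges used in some direction, \<open>F2\<close>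
    those used in both, so \<open>J\<close> has \<open>card F1 + card F2\<close> elements.\<close>
  define F1 where "F1 = (\<lambda>(u, w). {u, w}) ` J"
  define F2 where "F2 = (\<lambda>(u, w). {u, w}) ` (J \<inter> J\<inverse>)"
  have finJ: "finite J" using J finite_double_cover finite_subset by blast
  have sub: "J \<subseteq> V \<times> V" using J double_cover_subset by blast
  have ne: "u \<noteq> w" if "(u, w) \<in> J" for u w using that J edgeD[of u w] by (auto simp: double_cover_def)
  have "finite F1" using finJ by (simp add: F1_def)
  hence "card J = (\<Sum>e\<in>F1. card {x \<in> J. (\<lambda>(u, w). {u, w}) x = e})"
    using sum_fun_comp[OF finJ _ eq_refl[OF F1_def[symmetric]], of "\<lambda>_. 1 :: nat"] by simp
  also have "\<dots> = (\<Sum>e\<in>F1. 1 + (if e \<in> F2 then 1 else 0))"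
  proof (rule sum.cong)
    fix e assume "e \<in> F1"
    then obtain u w where uw: "(u, w) \<in> J" "e = {u, w}" by (auto simp: F1_def)
    have iff: "(\<lambda>(u, w). {u, w}) x = e \<longleftrightarrow> x = (u, w) \<or> x = (w, u)" for x
      using uw(2) by (cases x) (simp add: doubleton_eq_iff)
    have F2: "e \<in> F2 \<longleftrightarrow> (w, u) \<in> J"
    proof
      assume "e \<in> F2"
      then obtain x where x: "x \<in> J" "x \<in> J\<inverse>" "(\<lambda>(u, w). {u, w}) x = e"
        unfolding F2_def by (elim imageE IntE) simp
      have "x = (u, w) \<or> x = (w, u)" using iff x(3) by blast
      thus "(w, u) \<in> J" using x(1,2) by auto
    next
      assume "(w, u) \<in> J"
      hence "(u, w) \<in> J \<inter> J\<inverse>" using uw(1) by simp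
      moreover have "e = (\<lambda>(u, w). {u, w}) (u, w)" using uw(2) by simp
      ultimately show "e \<in> F2" unfolding F2_def by (rule rev_image_eqI)
    qed
    show "card {x \<in> J. (\<lambda>(u, w). {u, w}) x = e} = 1 + (if e \<in> F2 then 1 else 0)"
    proof (cases "(w, u) \<in> J")
      case True
      hence "{x \<in> J. x = (u, w) \<or> x = (w, u)} = {(u, w), (w, u)}" using uw(1) by auto
      hence "{x \<in> J. (\<lambda>(u, w). {u, w}) x = e} = {(u, w), (w, u)}" unfolding iff .
      thus ?thesis using ne[OF uw(1)] True F2 by simp
    next
      case False
      hence "{x \<in> J. x = (u, w) \<or> x = (w, u)} = {(u, w)}" using uw(1) by auto
      hence "{x \<in> J. (\<lambda>(u, w). {u, w}) x = e} = {(u, w)}" unfolding iff .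
      thus ?thesis using False F2 by simp
    qed
  qed simp
  also have "\<dots> = card F1 + card F2"
  proof -
    have "F2 \<subseteq> F1" "finite F1" using finJ by (auto simp: F1_def F2_def)
    thus ?thesis unfolding sum.distrib by (simp add: sum.If_cases Int_absorb1)
  qed
  finally have card_J: "card J = card F1 + card F2" .
  have W: "W \<subseteq> V" "Y \<subseteq> V" "W \<noteq> {}" using sub J by (auto simp: W_def Y_def)
  have F: "F1 \<subseteq> E" "F2 \<subseteq> E" using J by (auto simp: F1_def F2_def double_cover_def)
  have 1: "2 * real (card F1) \<le> mad V E * real (card (W \<union> Y))"
    using W F by (intro subgraph_edges_le) (auto simp: F1_def W_def Y_def)
  have 2: "2 * real (card F2) \<le> mad V E * real (card (W \<inter> Y))"
  proof (cases "W \<inter> Y = {}")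
    case True
    hence "F2 = {}" by (auto simp: F2_def W_def Y_def)
    thus ?thesis using True by simp
  next
    case False
    thus ?thesis using W F by (intro subgraph_edges_le) (auto simp: F2_def W_def Y_def)
  qed
  have "finite W" "finite Y" using W finite_subset[OF _ finite_V] by simp_all
  hence "card (W \<union> Y) + card (W \<inter> Y) = card W + card Y" by (rule card_Un_Int[symmetric])
  hence "real (card W) + real (card Y) = real (card (W \<union> Y)) + real (card (W \<inter> Y))" by linarith
  hence "mad V E * (real (card W) + real (card Y)) = mad V E * real (card (W \<union> Y)) + mad V E * real (card (W \<inter> Y))"
    by (simp only: distrib_left)
  hence "2 * real (card J) \<le> mad V E * (real (card W) + real (card Y))" using 1 2 card_J by simp
  thus ?thesis by (simp only: W_def Y_def)
qed

section \<open>Injective colourings as point colourings, and the two bounds\<close>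

lemma injective_coloring_iff:
  "injective_coloring V E c \<longleftrightarrow>
     (\<forall>u v w. {u, w} \<in> E \<and> {v, w} \<in> E \<and> u \<noteq> v \<longrightarrow> c u \<noteq> c v)"
  unfolding injective_coloring_def using edgeD by blast

lemma injective_chromatic_number_le:
  assumes "injective_coloring V E (c :: 'a \<Rightarrow> nat)" "\<And>p. c p < K"
  shows "injective_chromatic_number V E \<le> K"
proof -
  have "injective_chromatic_number V E \<le> card (c ` V)"
    unfolding injective_chromatic_number_def using assms(1) by (intro Least_le) blast
  also have "\<dots> \<le> card {..<K}" using assms(2) by (intro card_mono) auto
  finally show ?thesis by simp
qed

lemma injective_chromatic_number_le_if_point_coloring:
  assumes "point_coloring (double_cover E) K c"
  shows "injective_chromatic_number V E \<le> K"
  by (rule injective_chromatic_number_le[of c])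
    (use assms in \<open>auto simp: injective_coloring_iff point_coloring_def double_cover_def\<close>)

lemma max_degree_le_card_colors:
  assumes c: "injective_coloring V E c"
  shows "max_degree V E \<le> card (c ` V)"
proof -
  have "degree E v \<le> card (c ` V)" for v
  proof -
    have "inj_on c {u. {u, v} \<in> E}" using c unfolding injective_coloring_iff inj_on_def by blast
    hence "degree E v = card (c ` {u. {u, v} \<in> E})" by (simp add: degree_def card_image)
    also have "\<dots> \<le> card (c ` V)" using finite_V edgeD by (intro card_mono) auto
    finally show ?thesis .
  qed
  thus ?thesis unfolding max_degree_def using finite_V by (intro Max.boundedI) auto
qed

lemma max_degree_le_injective_chromatic_number:
  "max_degree V E \<le> injective_chromatic_number V E"
proof -
  \<comment> \<open>Some injective colouring must exist for the \<open>LEAST\<close> to be attained;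
    a map injective on \<open>V\<close> is one.\<close>
  have "\<exists>c :: 'a \<Rightarrow> nat. inj_on c V" using finite_V finite_imp_inj_to_nat_seg by blast
  then obtain c :: "'a \<Rightarrow> nat" where "inj_on c V" by blast
  hence "injective_coloring V E c" by (auto simp: injective_coloring_def inj_on_def)
  hence "\<exists>k. \<exists>c :: 'a \<Rightarrow> nat. injective_coloring V E c \<and> card (c ` V) = k" by blast
  from LeastI_ex[OF this] obtain c :: "'a \<Rightarrow> nat"
    where "injective_coloring V E c" "card (c ` V) = injective_chromatic_number V E"
    unfolding injective_chromatic_number_def by blast
  thus ?thesis using max_degree_le_card_colors by metis
qed

lemma injective_chromatic_number_le_if_mad_le_5_2:
  assumes "mad V E \<le> 5 / 2"
  shows "injective_chromatic_number V E \<le> max_degree V E + 1"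
proof -
  have "4 * card J \<le> 5 * (card (Domain J) + card (Range J))" if J: "J \<subseteq> double_cover E" for J
  proof (cases "J = {}")
    case False
    let ?n = "real (card (Domain J)) + real (card (Range J))"
    have "mad V E * ?n \<le> 5 / 2 * ?n" using assms by (intro mult_right_mono) auto
    hence "4 * real (card J) \<le> 5 * ?n" using double_cover_sparse[OF J False] by linarith
    hence "real (4 * card J) \<le> real (5 * (card (Domain J) + card (Range J)))" by simp
    thus ?thesis unfolding of_nat_le_iff .
  qed simp
  then obtain c where "point_coloring (double_cover E) (max_degree V E + 1) c"
    using point_colorable_sparse_5_2[OF finite_double_cover double_cover_point_degree double_cover_block_size] by blast
  thus ?thesis by (rule injective_chromatic_number_le_if_point_coloring)
qed

lemma injective_chromatic_number_le_if_mad_less_42_19: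
  assumes \<Delta>: "max_degree V E \<notin> {0, 2}" and mad: "mad V E < 42 / 19"
  shows "injective_chromatic_number V E \<le> max_degree V E"
proof (cases "max_degree V E = 1")
  \<comment> \<open>With maximum degree 1 no two vertices have a common neighbour, so one colour is
    enough.\<close>
  case True
  have "u = v" if "{u, w} \<in> E" "{v, w} \<in> E" for u v w
  proof -
    have "{x. {x, w} \<in> E} \<subseteq> V" using edgeD(1) by auto
    hence "finite {x. {x, w} \<in> E}" by (rule finite_subset[OF _ finite_V])
    moreover have "card {x. {x, w} \<in> E} \<le> Suc 0" using card_neighbours_le[of w] True by simp
    ultimately have "\<forall>x\<in>{x. {x, w} \<in> E}. \<forall>y\<in>{x. {x, w} \<in> E}. x = y"
      by (rule card_le_Suc0_iff_eq[THEN iffD1])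
    thus ?thesis using that by simp
  qed
  hence "injective_coloring V E (\<lambda>_. 0 :: nat)" unfolding injective_coloring_iff by metis
  thus ?thesis using injective_chromatic_number_le[of "\<lambda>_. 0" 1] True by simp
next
  case False
  hence k: "3 \<le> max_degree V E" using \<Delta> by auto
  have "19 * card J < 21 * (card (Domain J) + card (Range J))" if J: "J \<subseteq> double_cover E" "J \<noteq> {}" for J
  proof -
    let ?n = "real (card (Domain J)) + real (card (Range J))"
    have "finite J" using J finite_double_cover finite_subset by blast
    \<comment> \<open>Positivity keeps the bound on \<open>mad\<close> strict after
      multiplication.\<close>
    hence "0 < ?n" using J by (intro add_pos_nonneg) (auto simp: card_gt_0_iff finite_Domain)
    hence "mad V E * ?n < 42 / 19 * ?n" using mad by (intro mult_strict_right_mono)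
    hence "19 * real (card J) < 21 * ?n" using double_cover_sparse[OF J] by linarith
    hence "real (19 * card J) < real (21 * (card (Domain J) + card (Range J)))" by simp
    thus ?thesis unfolding of_nat_less_iff .
  qed
  then obtain c where "point_coloring (double_cover E) (max_degree V E) c"
    using point_colorable_sparse_42_19[OF finite_double_cover double_cover_point_degree double_cover_block_size _ k] by blast
  thus ?thesis by (rule injective_chromatic_number_le_if_point_coloring)
qed

end

theorem theorem4:
  fixes V :: "'a set" and E :: "'a set set"
  assumes "simple_graph V E"
  shows "(mad V E \<le> 5 / 2 \<longrightarrow> injective_chromatic_number V E \<le> max_degree V E + 1) \<and>
         (max_degree V E \<notin> {0, 2} \<and> mad V E < 42 / 19 \<longrightarrow>
            injective_chromatic_number V E = max_degree V E)"
  using injective_chromatic_number_le_if_mad_le_5_2[OF assms] injective_chromatic_number_le_if_mad_less_42_19[OF assms]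
    max_degree_le_injective_chromatic_number[OF assms] by (auto intro: antisym)

end
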